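(* Let $k\ge 1$ and $\mathcal H=\mathbb C^{2^k}=(\mathbb C^2)^{\otimes k}$. Let $S\subset\mathbb B(\mathcal H)$ be a Hörmander system for $\mathfrak{su}(2^k)$ with $$a=|0\rangle\langle 1|\otimes I^{\otimes (k-1)}\in S .$$ Then $\overline{\mathrm{Channel}^*(S)}$ contains all the replacer channels, i.e. $\mathcal R_\sigma\in\overline{\mathrm{Channel}^*(S)}$ for all $\sigma\in\mathcal D(\mathcal H)$, where $\mathcal R_\sigma(x)=\mathrm{tr}(x)\,\sigma$. In particular $\overline{\mathrm{Channel}^*(S)}$ is transitive.
   Context: $\mathbb B(\mathcal H)$ is the algebra of linear operators on $\mathcal H$; $\mathcal D(\mathcal H)=\{\rho\in\mathbb B(\mathcal H):\rho=\rho^*,\rho\ge 0,\mathrm{tr}\,\rho=1\}$ is the set of states. $|0\rangle,|1\rangle$ is the standard basis of $\mathbb C^2$ and $I$ the identity on $\mathbb C^2$. All spans are complex linear spans. Hörmander system: a set of anti-Hermitian operators on a $d$-dimensional space whose iterated commutators span $\mathfrak{su}(d)$. A resource set $S$ that also contains non-anti-Hermitian operators is called a Hörmander system if the real Lie algebra generated by the anti-Hermitian operators in $\mathrm{span}(S)$ contains $\mathfrak{su}(d)$. For $a\in\mathbb B(\mathcal H)$ let $L_a(\rho)=2a\rho a^*-a^*a\rho-\rho a^*a$. $\overline{\mathrm{Channel}^*(S)}$ is the smallest class of maps on $\mathbb B(\mathcal H)$ such that: (UN) if $iH\in\mathrm{span}(S)$ is anti-Hermitian, then $\rho\mapsto e^{itH}\rho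 e^{-itH}$ belongs to the class for all $t\ge 0$; (JU) for every $a\in S$ and $t\ge 0$, $e^{tL_a}$ belongs to the class; (CO) the class is closed under composition; (CL) the class is topologically closed; (CV) the class is convex. A set $\mathcal O$ of operations is transitive if for all $\rho,\sigma\in\mathcal D(\mathcal H)$ there is $\Phi\in\mathcal O$ with $\Phi(\rho)=\sigma$, or (continuous setting) there is a family $(T_t)_{t\ge0}$ in $\mathcal O$ with $T_\tau(\rho)=\sigma$ for some $\tau>0$ or $\lim_{t\to\infty}T_t(\rho)=\sigma$. *)

theory Defs
  imports "HOL-Analysis.Analysis"
begin

section \<open>Operators\<close>

text \<open>Operators on the Hilbert space \<^typ>\<open>complex ^ 'n\<close> are matrices in the standard basis; the norm and
  topology on them are those of a finite-dimensional real vector space.\<close>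

type_synonym 'n op = "complex ^ 'n ^ 'n"

definition adj :: "'n::finite op \<Rightarrow> 'n op" where
  "adj A = map_matrix cnj (transpose A)"

definition hermitian :: "'n::finite op \<Rightarrow> bool" where
  "hermitian A \<longleftrightarrow> adj A = A"

definition anti_hermitian :: "'n::finite op \<Rightarrow> bool" where
  "anti_hermitian A \<longleftrightarrow> adj A = - A"

definition cinner :: "complex ^ 'n \<Rightarrow> complex ^ 'n::finite \<Rightarrow> complex" where
  "cinner u v = (\<Sum>i\<in>UNIV. cnj (u $ i) * v $ i)"

definition positive_op :: "'n::finite op \<Rightarrow> bool" where
  "positive_op A \<longleftrightarrow> (\<forall>v. cinner v (A *v v) \<in> \<real>\<^sub>\<ge>\<^sub>0)"

definition states :: "'n::finite op set" where
  "states = {\<rho>. hermitian \<rho> \<and> positive_op \<rho> \<and> trace \<rho> = 1}"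

text \<open>The library's \<^const>\<open>span\<close> is the real span, so the complex span needs its own scalar
  multiplication.\<close>

definition cscale :: "complex \<Rightarrow> 'n::finite op \<Rightarrow> 'n op" where
  "cscale c A = map_matrix ((*) c) A"

global_interpretation cop: vector_space "cscale :: complex \<Rightarrow> 'n::finite op \<Rightarrow> 'n op"
  defines cspan = cop.span
  by unfold_locales (simp_all add: cscale_def map_matrix_def vec_eq_iff algebra_simps)

definition commutator :: "'n::finite op \<Rightarrow> 'n op \<Rightarrow> 'n op" where
  "commutator A B = A ** B - B ** A"

text \<open>Neither matrices (whose \<^const>\<open>times\<close> is componentwise) nor bounded linear maps are a normed
  algebra in the library's sense, so \<^const>\<open>exp\<close> does not apply to them.\<close>

definition power_series_exp :: "('a \<Rightarrow> 'a \<Rightarrow> 'a) \<Rightarrow> 'a \<Rightarrow> 'a::real_normed_vector \<Rightarrow> 'a" where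
  "power_series_exp m e A = (\<Sum>n. (1 / fact n) *\<^sub>R ((m A ^^ n) e))"

definition op_exp :: "'n::finite op \<Rightarrow> 'n op" where
  "op_exp = power_series_exp (**) (mat 1)"


section \<open>Hoermander systems\<close>

definition su :: "'n::finite op set" where
  "su = {A. anti_hermitian A \<and> trace A = 0}"

definition real_lie_algebra :: "'n::finite op set \<Rightarrow> bool" where
  "real_lie_algebra L \<longleftrightarrow> subspace L \<and> (\<forall>A\<in>L. \<forall>B\<in>L. commutator A B \<in> L)"

text \<open>This is the notion for resource sets that may contain operators that are not anti-Hermitian.
  If \<open>S\<close> consists of anti-Hermitian operators, the anti-Hermitian operators in its complex span
  are exactly its real span.\<close>

definition hormander_system :: "'n::finite op set \<Rightarrow> bool" where
  "hormander_system S \<longleftrightarrow> su \<subseteq> real_lie_algebra hull {A \<in> cspan S. anti_hermitian A}"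


section \<open>Channels\<close>

text \<open>All maps on operators that occur here are linear. They live in the normed space of bounded
  real-linear maps, whose notions \<^const>\<open>closed\<close> and \<^const>\<open>convex\<close> are the required ones:
  the complex-linear maps form a closed real subspace of it.\<close>

type_synonym 'n superop = "'n op \<Rightarrow>\<^sub>L 'n op"

definition superop_exp :: "'n::finite superop \<Rightarrow> 'n superop" where
  "superop_exp = power_series_exp (o\<^sub>L) id_blinfun"

lemma bounded_linear_two_sided_mult: "bounded_linear (\<lambda>\<rho>. U ** \<rho> ** V)"
  for U V :: "'n::finite op"
  by (auto simp: linear_conv_bounded_linear[symmetric] vec_eq_iff matrix_matrix_mult_def
      distrib_left distrib_right sum.distrib scaleR_sum_right sum_distrib_right intro!: linearI)

lift_definition two_sided_mult :: "'n::finite op \<Rightarrow> 'n op \<Rightarrow> 'n superop" is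
  "\<lambda>U V \<rho>. U ** \<rho> ** V"
  by (rule bounded_linear_two_sided_mult)

lift_definition jump_generator :: "'n::finite op \<Rightarrow> 'n superop" is
  "\<lambda>a \<rho>. 2 *\<^sub>R (a ** \<rho> ** adj a) - adj a ** a ** \<rho> - \<rho> ** adj a ** a"
proof -
  fix a :: "'n op"
  have "bounded_linear (\<lambda>\<rho> :: 'n op. adj a ** a ** \<rho>)" "bounded_linear (\<lambda>\<rho> :: 'n op. \<rho> ** adj a ** a)"
    using bounded_linear_two_sided_mult[of "adj a ** a" "mat 1"]
      bounded_linear_two_sided_mult[of "mat 1" "adj a ** a"]
    by (simp_all add: matrix_mul_assoc)
  then show "bounded_linear (\<lambda>\<rho>. 2 *\<^sub>R (a ** \<rho> ** adj a) - adj a ** a ** \<rho> - \<rho> ** adj a ** a)"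
    by (intro bounded_linear_sub bounded_linear_const_scaleR bounded_linear_two_sided_mult)
qed

lift_definition replacer :: "'n::finite op \<Rightarrow> 'n superop" is
  "\<lambda>\<sigma> x. cscale (trace x) \<sigma>"
  by (auto simp: linear_conv_bounded_linear[symmetric] cscale_def map_matrix_def trace_def
      vec_eq_iff sum.distrib scaleR_sum_right distrib_right sum_distrib_right intro!: linearI)

definition channel_class :: "'n::finite op set \<Rightarrow> 'n superop set \<Rightarrow> bool" where
  "channel_class S C \<longleftrightarrow>
     (\<forall>H. cscale \<i> H \<in> cspan S \<and> anti_hermitian (cscale \<i> H) \<longrightarrow>
        (\<forall>t\<ge>0. two_sided_mult (op_exp (t *\<^sub>R cscale \<i> H)) (op_exp (- (t *\<^sub>R cscale \<i> H))) \<in> C)) \<and>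
     (\<forall>a\<in>S. \<forall>t\<ge>0. superop_exp (t *\<^sub>R jump_generator a) \<in> C) \<and>
     (\<forall>\<Phi>\<in>C. \<forall>\<Psi>\<in>C. \<Phi> o\<^sub>L \<Psi> \<in> C) \<and>
     closed C \<and>
     convex C"

definition channel_closure :: "'n::finite op set \<Rightarrow> 'n superop set" where
  "channel_closure S = \<Inter>{C. channel_class S C}"

text \<open>The first alternative is the discrete setting, the other two are the continuous one.\<close>

definition transitive_ops :: "'n::finite superop set \<Rightarrow> bool" where
  "transitive_ops \<O> \<longleftrightarrow>
     (\<forall>\<rho>\<in>states. \<forall>\<sigma>\<in>states.
        (\<exists>\<Phi>\<in>\<O>. blinfun_apply \<Phi> \<rho> = \<sigma>) \<or>
        (\<exists>T :: real \<Rightarrow> 'n superop. (\<forall>t\<ge>0. T t \<in> \<O>) \<and>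
           ((\<exists>\<tau>>0. blinfun_apply (T \<tau>) \<rho> = \<sigma>) \<or>
            ((\<lambda>t. blinfun_apply (T t) \<rho>) \<longlongrightarrow> \<sigma>) at_top)))"


section \<open>Qubits\<close>

text \<open>The basis of a tensor product of qubits, one for each element of the finite linear order \<open>'k\<close>,
  is indexed by the bit strings \<^typ>\<open>'k \<Rightarrow> 2\<close>. So \<open>k = CARD('k) \<ge> 1\<close>, the dimension is \<open>2 ^ k\<close>, and
  the first tensor factor is the one at the least element of \<open>'k\<close>.\<close>

type_synonym 'k bits = "'k \<Rightarrow> 2"

definition tensor :: "('k::finite \<Rightarrow> 2 op) \<Rightarrow> 'k bits op" where
  "tensor A = (\<chi> x y. \<Prod>i\<in>UNIV. A i $ x i $ y i)"

definition ketbra :: "2 \<Rightarrow> 2 \<Rightarrow> 2 op" where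
  "ketbra i j = (\<chi> x y. axis i 1 $ x * cnj (axis j 1 $ y))"

text \<open>The operator \<open>\<bar>0\<rangle>\<langle>1\<bar> \<otimes> I \<otimes> \<dots> \<otimes> I\<close>.\<close>

definition lower_first :: "'k::{finite, linorder} bits op" where
  "lower_first = tensor (\<lambda>i. if i = Min UNIV then ketbra 0 1 else mat 1)"

end

theory Submission
  imports Defs
begin

text \<open>The operators \<open>A\<close> for which all \<open>exp (t ad A)\<close> lie in the closure form a real Lie algebra: sums are handled by
  Chernoff's product formula and brackets by differentiating conjugates. So the closure contains conjugation by
  every unitary, of which only the Hermitian involutions \<open>V = - i exp (\<pi> i V / 2)\<close> are needed.
  The semigroup \<open>exp (t L\<^sub>a)\<close> tends to the reset of the first qubit; conjugating by qubit swaps resets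
  every qubit, and the composite of all these resets is the replacer of a basis state. Householder reflections
  turn it into the replacers of all pure states, and convexity gives the rest.\<close>

section \<open>Exponentials in Banach algebras\<close>

text \<open>The channel class is only a semigroup, whereas a Lie bracket is produced by conjugating
  with inverses. This works because the anti-Hermitian part of a complex span is closed under
  negation, so Hamiltonian evolutions form whole one-parameter groups; the dissipative semigroup
  enters through its limit at infinity alone. Generators are treated as superoperators:
  \<open>ad\<close> is a homomorphism of Lie algebras that kills scalars, so generating the
  traceless \<open>su\<close> suffices for conjugation by an involution of any trace. Hermitian
  involutions have explicit logarithms and are plentiful enough: qubit swaps are among them, and two
  unit vectors with real inner product are exchanged by a reflection. A phase, invisible in the pure
  state, makes the inner product real.\<close>

lemma norm_exp_minus_linear_le:
  fixes x :: "'a::{real_normed_algebra_1,banach}"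
  shows "norm (exp x - 1 - x) \<le> (norm x)\<^sup>2 * exp (norm x)"
proof -
  have le: "norm (inverse (fact (n + 2)) *\<^sub>R x ^ (n + 2)) \<le> (norm x)\<^sup>2 * (norm x ^ n /\<^sub>R fact n)" for n
  proof -
    have "norm (inverse (fact (n + 2)) *\<^sub>R x ^ (n + 2)) \<le> inverse (fact (n + 2)) * norm x ^ (n + 2)"
      by (simp add: norm_power_ineq del: fact_Suc power_Suc)
    also have "\<dots> \<le> inverse (fact n) * norm x ^ (n + 2)"
      by (intro mult_right_mono le_imp_inverse_le fact_mono) auto
    also have "\<dots> = (norm x)\<^sup>2 * (norm x ^ n /\<^sub>R fact n)"
      by (simp only: power_add real_scaleR_def mult_ac)
    finally show ?thesis .
  qed
  have s: "(\<lambda>n. (norm x)\<^sup>2 * (norm x ^ n /\<^sub>R fact n)) sums ((norm x)\<^sup>2 * exp (norm x))"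
    by (intro sums_mult exp_converges)
  have "norm (\<Sum>n. inverse (fact (n + 2)) *\<^sub>R x ^ (n + 2)) \<le> (\<Sum>n. (norm x)\<^sup>2 * (norm x ^ n /\<^sub>R fact n))"
    using le sums_summable[OF s] by (rule norm_suminf_le)
  then show ?thesis
    using sums_unique[OF s] exp_first_two_terms[of x] by simp
qed

text \<open>For constant \<open>Y\<close> this is the derivative of \<open>exp\<close> at 0. The
  argument may vary with \<open>n\<close> so that limits of generators are covered too; the
  quadratic remainder is O(1/n) because \<open>Y\<close> converges.\<close>

lemma tendsto_exp_scaled:
  fixes Y :: "nat \<Rightarrow> 'a::{real_normed_algebra_1,banach}"
  assumes "Y \<longlonglongrightarrow> y"
  shows "(\<lambda>n. real n *\<^sub>R (exp (Y n /\<^sub>R real n) - 1)) \<longlonglongrightarrow> y"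
proof (rule Lim_transform[OF assms])
  have "(\<lambda>n. (norm (Y n))\<^sup>2 * exp (norm (Y n)) * inverse (real n)) \<longlonglongrightarrow> (norm y)\<^sup>2 * exp (norm y) * 0"
    by (intro tendsto_intros assms lim_inverse_n)
  moreover have "norm (real n *\<^sub>R (exp (Y n /\<^sub>R real n) - 1) - Y n)
      \<le> (norm (Y n))\<^sup>2 * exp (norm (Y n)) * inverse (real n)" if "n > 0" for n
  proof -
    let ?z = "Y n /\<^sub>R real n"
    have "norm (Y n) * inverse (real n) \<le> norm (Y n) * 1"
      using that by (intro mult_left_mono) (auto simp: field_simps)
    then have z: "norm ?z \<le> norm (Y n)" by (simp add: mult.commute)
    have "real n *\<^sub>R (exp ?z - 1) - Y n = real n *\<^sub>R (exp ?z - 1 - ?z)"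
      using that by (simp add: scaleR_diff_right)
    also have "norm \<dots> \<le> real n * ((norm ?z)\<^sup>2 * exp (norm ?z))"
      by (subst norm_scaleR) (auto intro!: mult_left_mono norm_exp_minus_linear_le simp del: norm_scaleR)
    also have "\<dots> = (norm (Y n))\<^sup>2 * inverse (real n) * exp (norm ?z)"
      using that by (simp add: power2_eq_square field_simps)
    also have "\<dots> \<le> (norm (Y n))\<^sup>2 * inverse (real n) * exp (norm (Y n))"
      using z by (intro mult_left_mono) auto
    finally show ?thesis by (simp only: mult_ac)
  qed
  then have "\<forall>\<^sub>F n in sequentially. norm (real n *\<^sub>R (exp (Y n /\<^sub>R real n) - 1) - Y n)
      \<le> (norm (Y n))\<^sup>2 * exp (norm (Y n)) * inverse (real n)"
    by (rule eventually_mono[OF eventually_gt_at_top])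
  ultimately show "(\<lambda>n. real n *\<^sub>R (exp (Y n /\<^sub>R real n) - 1) - Y n) \<longlonglongrightarrow> 0"
    unfolding mult_zero_right by (rule Lim_null_comparison[rotated])
qed

lemma tendsto_exp_divide_nat:
  fixes y :: "'a::{real_normed_algebra_1,banach}"
  shows "(\<lambda>n. exp (y /\<^sub>R real n)) \<longlonglongrightarrow> 1"
proof -
  have "(\<lambda>n. inverse (real n) *\<^sub>R (real n *\<^sub>R (exp (y /\<^sub>R real n) - 1))) \<longlonglongrightarrow> 0 *\<^sub>R y"
    by (rule tendsto_scaleR[OF lim_inverse_n tendsto_exp_scaled[OF tendsto_const]])
  moreover have "\<forall>\<^sub>F n in sequentially.
      inverse (real n) *\<^sub>R (real n *\<^sub>R (exp (y /\<^sub>R real n) - 1)) = exp (y /\<^sub>R real n) - 1"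
    using eventually_gt_at_top[of 0] by eventually_elim simp
  ultimately have "(\<lambda>n. exp (y /\<^sub>R real n) - 1) \<longlonglongrightarrow> 0"
    by (simp add: Lim_transform_eventually)
  then show ?thesis by (rule LIM_zero_cancel)
qed

text \<open>Telescoping. The factor \<open>M\<close> on the left turns the usual exponent
  \<open>n - 1\<close> into \<open>n\<close>, so that no truncated subtraction appears at
  \<open>n = 0\<close>.\<close>

lemma norm_power_diff_le:
  fixes x y :: "'a::real_normed_algebra_1"
  assumes "norm x \<le> M" "norm y \<le> M"
  shows "M * norm (x ^ n - y ^ n) \<le> real n * M ^ n * norm (x - y)"
proof (induction n)
  case (Suc n)
  have M: "0 \<le> M" using assms(1) norm_ge_zero order_trans by blast
  have "x ^ Suc n - y ^ Suc n = x * (x ^ n - y ^ n) + (x - y) * y ^ n"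
    by (simp add: algebra_simps)
  then have "norm (x ^ Suc n - y ^ Suc n) \<le> norm x * norm (x ^ n - y ^ n) + norm (x - y) * norm (y ^ n)"
    by (metis norm_triangle_le add_mono norm_mult_ineq)
  also have "\<dots> \<le> M * norm (x ^ n - y ^ n) + norm (x - y) * M ^ n"
    using assms M by (intro add_mono mult_mono order_trans[OF norm_power_ineq] power_mono) auto
  also have "\<dots> \<le> real n * M ^ n * norm (x - y) + norm (x - y) * M ^ n"
    using Suc by simp
  finally have "norm (x ^ Suc n - y ^ Suc n) \<le> real (Suc n) * M ^ n * norm (x - y)"
    by (simp add: algebra_simps)
  then have "M * norm (x ^ Suc n - y ^ Suc n) \<le> M * (real (Suc n) * M ^ n * norm (x - y))"
    using M by (rule mult_left_mono)
  then show ?case by (simp add: mult_ac)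
qed simp

text \<open>Chernoff's product formula: \<open>X n\<close> and \<open>exp (y / n)\<close> differ by \<open>o(1 / n)\<close>, and their powers up to the
  \<open>n\<close>-th stay bounded.\<close>

lemma tendsto_power_exp:
  fixes X :: "nat \<Rightarrow> 'a::{real_normed_algebra_1,banach}"
  assumes "(\<lambda>n. real n *\<^sub>R (X n - 1)) \<longlonglongrightarrow> y"
  shows "(\<lambda>n. X n ^ n) \<longlonglongrightarrow> exp y"
proof -
  define E where "E n = exp (y /\<^sub>R real n)" for n
  have E: "(\<lambda>n. real n *\<^sub>R (E n - 1)) \<longlonglongrightarrow> y"
    unfolding E_def using tendsto_exp_scaled[of "\<lambda>_. y" y] by simp
  obtain K where K: "K > 0" "\<And>n. norm (real n *\<^sub>R (X n - 1)) \<le> K"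
    using convergent_imp_Bseq[OF convergentI[OF assms]] by (auto simp: Bseq_def)
  obtain K' where K': "K' > 0" "\<And>n. norm (real n *\<^sub>R (E n - 1)) \<le> K'"
    using convergent_imp_Bseq[OF convergentI[OF E]] by (auto simp: Bseq_def)
  \<comment> \<open>Both \<open>X n\<close> and \<open>E n\<close> lie within \<open>L / n\<close>
    of 1, so their powers up to the \<open>n\<close>-th are bounded by
    \<open>(1 + L / n) ^ n\<close>, hence by \<open>exp L\<close>.\<close>
  define L where "L = max K K'"
  have bound: "norm z \<le> 1 + L / real n" if "norm (real n *\<^sub>R (z - 1)) \<le> L" "n > 0" for z :: 'a and n
  proof -
    have "norm (z - 1) \<le> L / real n" using that by (simp add: pos_le_divide_eq mult.commute)
    then show ?thesis using norm_triangle_ineq[of 1 "z - 1"] by simp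
  qed
  have pow: "(1 + L / real n) ^ n \<le> exp L" if "n > 0" for n
  proof -
    have "(1 + L / real n) ^ n \<le> exp (L / real n) ^ n"
      using K by (intro power_mono exp_ge_add_one_self) (auto simp: L_def intro!: add_nonneg_nonneg)
    then show ?thesis using that by (simp add: exp_of_nat_mult[symmetric])
  qed
  have le: "norm (X n ^ n - E n ^ n) \<le> exp L * norm (real n *\<^sub>R (X n - 1) - real n *\<^sub>R (E n - 1))" if "n > 0" for n
  proof -
    define M where "M = 1 + L / real n"
    have M: "M \<ge> 1" using K by (simp add: M_def L_def)
    have "norm (X n) \<le> M" "norm (E n) \<le> M"
      unfolding M_def L_def using K(2)[of n] K'(2)[of n] that
      by (intro bound[unfolded L_def]; simp del: norm_scaleR)+
    from norm_power_diff_le[OF this, of n]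
    have "M * norm (X n ^ n - E n ^ n) \<le> M ^ n * (real n * norm (X n - E n))" by (simp add: mult_ac)
    also have "\<dots> \<le> exp L * (real n * norm (X n - E n))"
      using pow[OF that] unfolding M_def by (intro mult_right_mono) auto
    finally have "norm (X n ^ n - E n ^ n) \<le> exp L * (real n * norm (X n - E n))"
      using M mult_right_mono[OF M norm_ge_zero, of "X n ^ n - E n ^ n"] by linarith
    also have "real n * norm (X n - E n) = norm (real n *\<^sub>R (X n - 1) - real n *\<^sub>R (E n - 1))"
      by (simp flip: scaleR_diff_right)
    finally show ?thesis .
  qed
  have "(\<lambda>n. exp L * norm (real n *\<^sub>R (X n - 1) - real n *\<^sub>R (E n - 1))) \<longlonglongrightarrow> exp L * norm (y - y)"
    by (intro tendsto_intros assms E)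
  then have "(\<lambda>n. X n ^ n - E n ^ n) \<longlonglongrightarrow> 0"
    unfolding diff_self norm_zero mult_zero_right
    by (rule Lim_null_comparison[rotated]) (rule eventually_mono[OF eventually_gt_at_top le])
  moreover have "E n ^ n = exp y" if "n > 0" for n
  proof -
    have "exp (real m *\<^sub>R z) = exp z ^ m" for z :: 'a and m
      by (induction m) (simp_all add: scaleR_add_left exp_add_commuting)
    from this[of n "y /\<^sub>R real n"] show ?thesis using that by (simp add: E_def)
  qed
  then have "(\<lambda>n. E n ^ n) \<longlonglongrightarrow> exp y"
    by (intro tendsto_eventually eventually_mono[OF eventually_gt_at_top])
  ultimately have "(\<lambda>n. (X n ^ n - E n ^ n) + E n ^ n) \<longlonglongrightarrow> 0 + exp y"
    by (rule tendsto_add)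
  then show ?thesis by simp
qed

text \<open>All positive powers of \<open>q\<close> equal \<open>q\<close>, so the series beyond its
  constant term is scalar. This closed form lets the limit of the dissipative semigroup be read
  off.\<close>

lemma exp_scaleR_idempotent:
  fixes q :: "'a::{real_normed_algebra_1,banach}"
  assumes "q * q = q"
  shows "exp (s *\<^sub>R q) = 1 + (exp s - 1) *\<^sub>R q"
proof -
  have pow: "q ^ Suc n = q" for n
    by (induction n) (use assms in auto)
  have "(\<lambda>n. (s ^ Suc n /\<^sub>R fact (Suc n)) *\<^sub>R q) sums ((exp s - 1) *\<^sub>R q)"
    using exp_converges[of s] by (intro sums_scaleR_left) (subst sums_Suc_iff, simp)
  moreover have "(s ^ Suc n /\<^sub>R fact (Suc n)) *\<^sub>R q = (s *\<^sub>R q) ^ Suc n /\<^sub>R fact (Suc n)" for n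
    unfolding scaleR_power pow by simp
  ultimately have "(\<lambda>n. (s *\<^sub>R q) ^ Suc n /\<^sub>R fact (Suc n)) sums ((exp s - 1) *\<^sub>R q)"
    by simp
  then have "(\<lambda>n. (s *\<^sub>R q) ^ n /\<^sub>R fact n) sums ((exp s - 1) *\<^sub>R q + 1)"
    by (subst (asm) sums_Suc_iff) simp
  then show ?thesis
    using sums_unique2[OF exp_converges[of "s *\<^sub>R q"]] by (simp add: add.commute)
qed

lemma exp_conjugate:
  fixes x y z :: "'a::{real_normed_algebra_1,banach}"
  assumes "x * y = 1" "y * x = 1"
  shows "exp (x * z * y) = x * exp z * y"
proof -
  have pow: "(x * z * y) ^ n = x * z ^ n * y" for n
  proof (induction n)
    case (Suc n)
    have "(x * z * y) ^ Suc n = (x * z * y) * (x * z ^ n * y)" by (simp only: power_Suc Suc.IH)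
    also have "\<dots> = x * z * (y * x) * z ^ n * y" by (simp only: mult.assoc)
    finally show ?case using assms by (simp add: mult.assoc)
  qed (simp add: assms)
  have "(\<lambda>n. x * (z ^ n /\<^sub>R fact n) * y) sums (x * exp z * y)"
    by (intro sums_mult sums_mult2 exp_converges)
  then have "(\<lambda>n. (x * z * y) ^ n /\<^sub>R fact n) sums (x * exp z * y)"
    by (simp add: pow)
  then show ?thesis by (rule sums_unique2[OF exp_converges])
qed

text \<open>Euler's formula with \<open>j\<close> as imaginary unit; at \<open>pi / 2\<close> the
  cosine vanishes and the sine is 1.\<close>

lemma exp_half_pi_square_root_minus_one:
  fixes j :: "'a::{real_normed_algebra_1,banach}"
  assumes "j * j = - 1"
  shows "exp ((pi / 2) *\<^sub>R j) = j"
proof -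
  have pow: "j ^ (2 * m) = (- 1) ^ m *\<^sub>R 1" for m
    by (induction m) (simp_all add: assms mult.assoc[symmetric])
  have summand: "(s *\<^sub>R j) ^ n /\<^sub>R fact n = (cos_coeff n *\<^sub>R s ^ n) *\<^sub>R 1 + (sin_coeff n *\<^sub>R s ^ n) *\<^sub>R j" for s n
  proof (cases "even n")
    case True
    then obtain m where n: "n = 2 * m" by blast
    have "(s *\<^sub>R j) ^ n /\<^sub>R fact n = (s ^ n * (- 1) ^ m / fact n) *\<^sub>R 1"
      unfolding scaleR_power n pow by (simp add: divide_inverse mult_ac)
    moreover have "cos_coeff n = (- 1) ^ m / fact n" "sin_coeff n = 0"
      by (simp_all add: n cos_coeff_def sin_coeff_def)
    ultimately show ?thesis by (simp add: mult.commute)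
  next
    case False
    then obtain m where n: "n = Suc (2 * m)" by (auto elim!: oddE)
    have "(s *\<^sub>R j) ^ n /\<^sub>R fact n = (s ^ n * (- 1) ^ m / fact n) *\<^sub>R j"
      unfolding scaleR_power n power_Suc[of j] pow by (simp add: divide_inverse mult_ac del: fact_Suc power_Suc)
    moreover have "sin_coeff n = (- 1) ^ m / fact n" "cos_coeff n = 0"
      by (simp_all add: n cos_coeff_def sin_coeff_def del: fact_Suc)
    ultimately show ?thesis by (simp add: mult.commute)
  qed
  have "(\<lambda>n. (s *\<^sub>R j) ^ n /\<^sub>R fact n) sums (cos s *\<^sub>R 1 + sin s *\<^sub>R j)" for s
    unfolding summand by (intro sums_add sums_scaleR_left sin_converges cos_converges)
  from sums_unique2[OF exp_converges this] show ?thesis by simp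
qed

section \<open>The Banach algebra of superoperators\<close>

text \<open>A copy of the type of bounded linear maps, on which the ring operations and hence \<^const>\<open>exp\<close> are available.\<close>

typedef (overloaded) 'a endo = "UNIV :: ('a::{real_normed_vector, perfect_space} \<Rightarrow>\<^sub>L 'a) set"
  by simp

setup_lifting type_definition_endo

instantiation endo :: ("{real_normed_vector, perfect_space}") real_normed_vector
begin

lift_definition zero_endo :: "'a endo" is 0 .
lift_definition plus_endo :: "'a endo \<Rightarrow> 'a endo \<Rightarrow> 'a endo" is "(+)" .
lift_definition minus_endo :: "'a endo \<Rightarrow> 'a endo \<Rightarrow> 'a endo" is "(-)" .
lift_definition uminus_endo :: "'a endo \<Rightarrow> 'a endo" is uminus .
lift_definition scaleR_endo :: "real \<Rightarrow> 'a endo \<Rightarrow> 'a endo" is scaleR .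
lift_definition norm_endo :: "'a endo \<Rightarrow> real" is norm .
definition dist_endo :: "'a endo \<Rightarrow> 'a endo \<Rightarrow> real" where "dist_endo x y = norm (x - y)"
definition sgn_endo :: "'a endo \<Rightarrow> 'a endo" where "sgn_endo x = scaleR (inverse (norm x)) x"
definition uniformity_endo :: "('a endo \<times> 'a endo) filter" where
  "uniformity_endo = (INF e\<in>{0<..}. principal {(x, y). dist x y < e})"
definition open_endo :: "'a endo set \<Rightarrow> bool" where
  "open_endo U \<longleftrightarrow> (\<forall>x\<in>U. eventually (\<lambda>(x', y). x' = x \<longrightarrow> y \<in> U) uniformity)"

instance
proof
  fix x y z :: "'a endo" and r s :: real and U :: "'a endo set"
  show "x + y + z = x + (y + z)" by transfer simp
  show "x + y = y + x" by transfer simp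
  show "0 + x = x" by transfer simp
  show "- x + x = 0" by transfer simp
  show "x - y = x + - y" by transfer simp
  show "r *\<^sub>R (x + y) = r *\<^sub>R x + r *\<^sub>R y" by transfer (simp add: scaleR_add_right)
  show "(r + s) *\<^sub>R x = r *\<^sub>R x + s *\<^sub>R x" by transfer (simp add: scaleR_add_left)
  show "r *\<^sub>R s *\<^sub>R x = (r * s) *\<^sub>R x" by transfer simp
  show "1 *\<^sub>R x = x" by transfer simp
  show "norm x = 0 \<longleftrightarrow> x = 0" by transfer simp
  show "norm (x + y) \<le> norm x + norm y" by transfer (rule norm_triangle_ineq)
  show "norm (r *\<^sub>R x) = \<bar>r\<bar> * norm x" by transfer simp
qed (fact dist_endo_def sgn_endo_def uniformity_endo_def open_endo_def)+

end

instantiation endo :: ("{real_normed_vector, perfect_space}") real_normed_algebra_1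
begin

lift_definition one_endo :: "'a endo" is id_blinfun .
lift_definition times_endo :: "'a endo \<Rightarrow> 'a endo \<Rightarrow> 'a endo" is "(o\<^sub>L)" .

instance
proof
  fix x y z :: "'a endo" and r :: real
  show "x * y * z = x * (y * z)" by transfer (rule blinfun_eqI, simp)
  show "(x + y) * z = x * z + y * z" by transfer (rule blinfun_eqI, simp add: blinfun.bilinear_simps)
  show "x * (y + z) = x * y + x * z" by transfer (rule blinfun_eqI, simp add: blinfun.bilinear_simps)
  show "r *\<^sub>R x * y = r *\<^sub>R (x * y)" by transfer (rule blinfun_eqI, simp add: blinfun.bilinear_simps)
  show "x * r *\<^sub>R y = r *\<^sub>R (x * y)" by transfer (rule blinfun_eqI, simp add: blinfun.bilinear_simps)
  show "1 * x = x" by transfer (rule blinfun_eqI, simp)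
  show "x * 1 = x" by transfer (rule blinfun_eqI, simp)
  show "norm (x * y) \<le> norm x * norm y" by transfer (rule norm_blinfun_compose)
  \<comment> \<open>Here \<open>perfect_space\<close> enters: it excludes the zero space, whose
    identity has norm 0.\<close>
  show "norm (1 :: 'a endo) = 1" by transfer simp
  then show "(0 :: 'a endo) \<noteq> 1" by (metis norm_zero zero_neq_one)
qed

end

lemma bounded_linear_Rep_endo: "bounded_linear (Rep_endo :: 'a::{real_normed_vector, perfect_space} endo \<Rightarrow> _)"
  by (rule bounded_linear_intro[of _ 1]; transfer) simp_all

lemma bounded_linear_Abs_endo: "bounded_linear (Abs_endo :: ('a::{real_normed_vector, perfect_space} \<Rightarrow>\<^sub>L 'a) \<Rightarrow> _)"
  by (rule bounded_linear_intro[of _ 1])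
    (simp_all add: norm_endo.rep_eq Abs_endo_inverse Rep_endo_inject[symmetric] plus_endo.rep_eq scaleR_endo.rep_eq)

instance endo :: ("{banach, perfect_space}") banach
proof
  fix X :: "nat \<Rightarrow> 'a endo"
  assume "Cauchy X"
  then have "Cauchy (\<lambda>n. Rep_endo (X n))"
    by (rule bounded_linear.Cauchy[OF bounded_linear_Rep_endo])
  then obtain l where "(\<lambda>n. Rep_endo (X n)) \<longlonglongrightarrow> l"
    using Cauchy_convergent_iff convergent_def by blast
  from bounded_linear.tendsto[OF bounded_linear_Abs_endo this]
  show "convergent X" by (auto simp: Rep_endo_inverse convergent_def)
qed

lemma Rep_endo_power: "Rep_endo (x ^ n) = ((o\<^sub>L) (Rep_endo x) ^^ n) id_blinfun"
  by (induction n) (simp_all add: one_endo.rep_eq times_endo.rep_eq)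

lemma Rep_endo_exp:
  fixes x :: "'n::finite op endo"
  shows "Rep_endo (exp x) = superop_exp (Rep_endo x)"
proof -
  have "(\<lambda>n. Rep_endo (x ^ n /\<^sub>R fact n)) sums Rep_endo (exp x)"
    by (intro bounded_linear.sums[OF bounded_linear_Rep_endo] exp_converges)
  then show ?thesis
    by (simp add: superop_exp_def power_series_exp_def sums_iff scaleR_endo.rep_eq Rep_endo_power inverse_eq_divide)
qed

section \<open>The Lie algebra of a closed multiplicative semigroup\<close>

context
  fixes C :: "'a::{real_normed_algebra_1, banach} set"
  assumes closed: "closed C"
    and one: "1 \<in> C"
    and mult: "\<And>x y. x \<in> C \<Longrightarrow> y \<in> C \<Longrightarrow> x * y \<in> C"
begin

text \<open>Negative \<open>t\<close> are included: this is the edge of the Lie wedge of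
  \<open>C\<close>, where the inverses needed for conjugation are available.\<close>

definition group_generators :: "'a set" where
  "group_generators = {g. \<forall>t. exp (t *\<^sub>R g) \<in> C}"

lemma power_mem: "x \<in> C \<Longrightarrow> x ^ n \<in> C"
  by (induction n) (auto intro: one mult)

text \<open>Only the first-order behaviour of \<open>X n\<close> at 1 matters, so sums and limits of
  generators follow from a suitable choice of \<open>X\<close>.\<close>

lemma exp_mem_of_tendsto:
  assumes "(\<lambda>n. real n *\<^sub>R (X n - 1)) \<longlonglongrightarrow> y" "\<And>n. X n \<in> C"
  shows "exp y \<in> C"
  by (rule closed_sequentially[OF closed _ tendsto_power_exp[OF assms(1)]]) (intro power_mem assms(2))

lemma group_generators_scaleR: "g \<in> group_generators \<Longrightarrow> r *\<^sub>R g \<in> group_generators"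
  by (simp add: group_generators_def)

text \<open>Lie-Trotter formula. The velocities add because
  \<open>X * Y - 1 = (X - 1) * Y + (Y - 1)\<close> and the second factor tends to 1.\<close>

lemma group_generators_add:
  assumes "g \<in> group_generators" "h \<in> group_generators"
  shows "g + h \<in> group_generators"
proof -
  have "exp (t *\<^sub>R (g + h)) \<in> C" for t
  proof (rule exp_mem_of_tendsto)
    define E where "E x n = exp ((t *\<^sub>R x) /\<^sub>R real n)" for x :: 'a and n
    have lim: "(\<lambda>n. real n *\<^sub>R (E x n - 1)) \<longlonglongrightarrow> t *\<^sub>R x" for x
      unfolding E_def by (intro tendsto_exp_scaled tendsto_const)
    have "E h \<longlonglongrightarrow> 1"
      unfolding E_def by (rule tendsto_exp_divide_nat)
    then have "(\<lambda>n. real n *\<^sub>R (E g n - 1) * E h n + real n *\<^sub>R (E h n - 1)) \<longlonglongrightarrow> t *\<^sub>R g * 1 + t *\<^sub>R h"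
      by (intro tendsto_add[OF tendsto_mult[OF lim] lim])
    moreover have "real n *\<^sub>R (E g n - 1) * E h n + real n *\<^sub>R (E h n - 1) = real n *\<^sub>R (E g n * E h n - 1)" for n
      by (simp add: algebra_simps)
    ultimately show "(\<lambda>n. real n *\<^sub>R (E g n * E h n - 1)) \<longlonglongrightarrow> t *\<^sub>R (g + h)"
      by (simp only: scaleR_add_right mult_1_right)
    show "E g n * E h n \<in> C" for n
      using assms by (simp add: E_def group_generators_def mult)
  qed
  then show ?thesis by (simp add: group_generators_def)
qed

text \<open>The product formula allows the direction to change with \<open>n\<close>. Brackets,
  being limits of difference quotients, depend on this.\<close>

lemma group_generators_closed:
  assumes "\<And>n. G n \<in> group_generators" "G \<longlonglongrightarrow> g"
  shows "g \<in> group_generators"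
proof -
  have "exp (t *\<^sub>R g) \<in> C" for t
  proof (rule exp_mem_of_tendsto)
    show "(\<lambda>n. real n *\<^sub>R (exp ((t *\<^sub>R G n) /\<^sub>R real n) - 1)) \<longlonglongrightarrow> t *\<^sub>R g"
      by (intro tendsto_exp_scaled tendsto_scaleR[OF tendsto_const] assms(2))
    show "exp ((t *\<^sub>R G n) /\<^sub>R real n) \<in> C" for n
      using assms(1)[of n] by (simp add: group_generators_def)
  qed
  then show ?thesis by (simp add: group_generators_def)
qed

text \<open>\<open>[g, h]\<close> is the derivative at \<open>0\<close> of the curve \<open>exp (s g) h exp (- s g)\<close>, which consists of generators.\<close>

lemma group_generators_commutator:
  assumes "g \<in> group_generators" "h \<in> group_generators"
  shows "g * h - h * g \<in> group_generators"
proof (rule group_generators_closed)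
  define E where "E x n = exp (x /\<^sub>R real n)" for x :: 'a and n
  have lim: "(\<lambda>n. real n *\<^sub>R (E x n - 1)) \<longlonglongrightarrow> x" for x
    unfolding E_def by (intro tendsto_exp_scaled tendsto_const)
  have "E (- g) \<longlonglongrightarrow> 1" unfolding E_def by (rule tendsto_exp_divide_nat)
  \<comment> \<open>Product rule for the difference quotient with step \<open>1 / n\<close>. Below,
    \<open>- h\<close> is written as a multiple of \<open>h\<close> so that closure under sums and
    multiples applies.\<close>
  then have "(\<lambda>n. real n *\<^sub>R (E g n - 1) * h * E (- g) n + h * (real n *\<^sub>R (E (- g) n - 1))) \<longlonglongrightarrow> g * h * 1 + h * (- g)"
    by (intro tendsto_add[OF tendsto_mult[OF tendsto_mult_right[OF lim]] tendsto_mult_left[OF lim]])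
  moreover have "real n *\<^sub>R (E g n - 1) * h * E (- g) n + h * (real n *\<^sub>R (E (- g) n - 1))
      = real n *\<^sub>R (E g n * h * E (- g) n + (- 1) *\<^sub>R h)" for n
    by (simp add: algebra_simps)
  ultimately show "(\<lambda>n. real n *\<^sub>R (E g n * h * E (- g) n + (- 1) *\<^sub>R h)) \<longlonglongrightarrow> g * h - h * g"
    by simp
  have "E g n * h * E (- g) n \<in> group_generators" for n
  proof -
    have inv: "E g n * E (- g) n = 1" "E (- g) n * E g n = 1"
      using exp_minus_inverse[of "g /\<^sub>R real n"] exp_minus_inverse[of "- g /\<^sub>R real n"] by (simp_all add: E_def)
    have "exp (t *\<^sub>R (E g n * h * E (- g) n)) = E g n * exp (t *\<^sub>R h) * E (- g) n" for t
      using exp_conjugate[OF inv, of "t *\<^sub>R h"] by simp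
    moreover have "exp (t *\<^sub>R g) \<in> C" for t
      using assms(1) by (simp add: group_generators_def)
    from this[of "inverse (real n)"] this[of "- inverse (real n)"] have "E g n \<in> C" "E (- g) n \<in> C"
      by (simp_all add: E_def)
    ultimately show ?thesis
      using assms(2) by (simp add: group_generators_def mult)
  qed
  then show "real n *\<^sub>R (E g n * h * E (- g) n + (- 1) *\<^sub>R h) \<in> group_generators" for n
    using assms(2) by (blast intro: group_generators_scaleR group_generators_add)
qed

end

section \<open>Operators and two-sided multiplications\<close>

interpretation op_mult: bounded_bilinear "(**) :: 'n::finite op \<Rightarrow> 'n op \<Rightarrow> 'n op"
proof (subst bilinear_conv_bounded_bilinear[symmetric])
  show "bilinear ((**) :: 'n op \<Rightarrow> 'n op \<Rightarrow> 'n op)"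
    by (auto simp: bilinear_def vec_eq_iff matrix_matrix_mult_def algebra_simps sum.distrib scaleR_sum_right
        intro!: linearI)
qed

lemma cscale_mult [simp]: "cscale c A ** B = cscale c (A ** B)" "A ** cscale c B = cscale c (A ** B)"
  by (simp_all add: cscale_def map_matrix_def vec_eq_iff matrix_matrix_mult_def sum_distrib_left algebra_simps)

lemma cscale_minus_one: "cscale (- 1) A = - A"
  by (simp add: cscale_def map_matrix_def vec_eq_iff)

lemma adj_nth: "adj A $ x $ y = cnj (A $ y $ x)"
  by (simp add: adj_def map_matrix_def transpose_def)

lemma adj_diff: "adj (A - B) = adj A - adj B"
  and adj_uminus: "adj (- A) = - adj A"
  and adj_cscale: "adj (cscale c A) = cscale (cnj c) (adj A)"
  and adj_one: "adj (mat 1) = mat 1"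
  and adj_mult: "adj (A ** B) = adj B ** adj A"
  and adj_adj: "adj (adj A) = A"
  by (simp_all add: vec_eq_iff adj_nth cscale_def map_matrix_def mat_def matrix_matrix_mult_def mult.commute)

definition sandwich :: "'n::finite op \<Rightarrow> 'n op \<Rightarrow> 'n op endo" where
  "sandwich A B = Abs_endo (two_sided_mult A B)"

lemma Rep_sandwich: "Rep_endo (sandwich A B) = two_sided_mult A B"
  by (simp add: sandwich_def Abs_endo_inverse)

lemma endo_eqI: "(\<And>\<rho>. blinfun_apply (Rep_endo x) \<rho> = blinfun_apply (Rep_endo y) \<rho>) \<Longrightarrow> x = y"
  by (metis Rep_endo_inject blinfun_eqI)

lemmas endo_apply_simps = Rep_sandwich two_sided_mult.rep_eq plus_endo.rep_eq minus_endo.rep_eq uminus_endo.rep_eq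
  scaleR_endo.rep_eq times_endo.rep_eq one_endo.rep_eq zero_endo.rep_eq blinfun.bilinear_simps blinfun_apply_blinfun_compose

lemma sandwich_mult: "sandwich A B * sandwich C D = sandwich (A ** C) (D ** B)"
  by (rule endo_eqI) (simp add: endo_apply_simps matrix_mul_assoc)

lemma sandwich_one: "sandwich (mat 1) (mat 1) = 1"
  by (rule endo_eqI) (simp add: endo_apply_simps)

interpretation sandwich: bounded_bilinear "sandwich :: 'n::finite op \<Rightarrow> 'n op \<Rightarrow> 'n op endo"
proof (subst bilinear_conv_bounded_bilinear[symmetric])
  show "bilinear (sandwich :: 'n op \<Rightarrow> 'n op \<Rightarrow> 'n op endo)"
    by (auto simp: bilinear_def endo_apply_simps op_mult.add_left op_mult.add_right op_mult.scaleR_left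
        op_mult.scaleR_right intro!: linearI endo_eqI)
qed

lemma sandwich_power:
  "sandwich A (mat 1) ^ n = sandwich (((**) A ^^ n) (mat 1)) (mat 1)"
  "sandwich (mat 1) A ^ n = sandwich (mat 1) (((**) A ^^ n) (mat 1))"
proof (induction n)
  case (Suc n)
  show "sandwich A (mat 1) ^ Suc n = sandwich (((**) A ^^ Suc n) (mat 1)) (mat 1)"
    unfolding power_Suc Suc by (simp add: sandwich_mult)
  show "sandwich (mat 1) A ^ Suc n = sandwich (mat 1) (((**) A ^^ Suc n) (mat 1))"
    \<comment> \<open>Right multiplication reverses products, so splitting off the last factor puts
      the new \<open>A\<close> in front.\<close>
    unfolding power_Suc2 Suc by (simp add: sandwich_mult)
qed (simp_all add: sandwich_one)

text \<open>Convergence is inherited from the superoperators: the series is that of left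
  multiplication by \<open>A\<close>, evaluated at the identity.\<close>

lemma op_exp_sums: "(\<lambda>n. ((**) A ^^ n) (mat 1) /\<^sub>R fact n) sums op_exp A"
proof -
  have "bounded_linear (\<lambda>x. blinfun_apply (Rep_endo x) (mat 1))"
    by (intro bounded_linear_compose[OF blinfun.bounded_linear_left bounded_linear_Rep_endo])
  from bounded_linear.sums[OF this exp_converges[of "sandwich A (mat 1)"]]
  have "(\<lambda>n. ((**) A ^^ n) (mat 1) /\<^sub>R fact n) sums blinfun_apply (Rep_endo (exp (sandwich A (mat 1)))) (mat 1)"
    by (simp add: sandwich_power endo_apply_simps)
  then show ?thesis
    by (simp add: op_exp_def power_series_exp_def inverse_eq_divide sums_iff)
qed

lemma exp_sandwich:
  "exp (sandwich A (mat 1)) = sandwich (op_exp A) (mat 1)"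
  "exp (sandwich (mat 1) A) = sandwich (mat 1) (op_exp A)"
proof -
  have "(\<lambda>n. sandwich A (mat 1) ^ n /\<^sub>R fact n) sums sandwich (op_exp A) (mat 1)"
    using bounded_linear.sums[OF sandwich.bounded_linear_left op_exp_sums]
    by (simp add: sandwich_power sandwich.scaleR_left)
  then show "exp (sandwich A (mat 1)) = sandwich (op_exp A) (mat 1)"
    by (rule sums_unique2[OF exp_converges])
  have "(\<lambda>n. sandwich (mat 1) A ^ n /\<^sub>R fact n) sums sandwich (mat 1) (op_exp A)"
    using bounded_linear.sums[OF sandwich.bounded_linear_right op_exp_sums]
    by (simp add: sandwich_power sandwich.scaleR_right)
  then show "exp (sandwich (mat 1) A) = sandwich (mat 1) (op_exp A)"
    by (rule sums_unique2[OF exp_converges])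
qed

definition ad :: "'n::finite op \<Rightarrow> 'n op endo" where
  "ad A = sandwich A (mat 1) - sandwich (mat 1) A"

lemma ad_add: "ad (A + B) = ad A + ad B"
  and ad_diff: "ad (A - B) = ad A - ad B"
  and ad_scaleR: "ad (r *\<^sub>R A) = r *\<^sub>R ad A"
  and ad_zero: "ad 0 = 0"
  by (simp_all add: ad_def sandwich.add_left sandwich.add_right sandwich.diff_left sandwich.diff_right
      sandwich.scaleR_left sandwich.scaleR_right sandwich.zero_left sandwich.zero_right algebra_simps)

lemma ad_commutator: "ad (commutator A B) = ad A * ad B - ad B * ad A"
  by (simp add: ad_def commutator_def sandwich.diff_left sandwich.diff_right sandwich_mult algebra_simps)

text \<open>This permits correcting the trace of a Hamiltonian without changing its
  evolution.\<close>

lemma ad_scalar: "ad (cscale c (mat 1)) = 0"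
  by (rule endo_eqI) (simp add: ad_def endo_apply_simps)

text \<open>Left and right multiplications commute, so the exponential of their difference
  factors.\<close>

lemma exp_ad: "exp (ad A) = sandwich (op_exp A) (op_exp (- A))"
proof -
  have "exp (ad A) = exp (sandwich A (mat 1) + sandwich (mat 1) (- A))"
    by (simp add: ad_def sandwich.minus_right)
  also have "\<dots> = exp (sandwich A (mat 1)) * exp (sandwich (mat 1) (- A))"
    by (intro exp_add_commuting) (simp add: sandwich_mult)
  finally show ?thesis by (simp add: exp_sandwich sandwich_mult)
qed

section \<open>Conjugations in the channel closure\<close>

definition channel_endos :: "'n::finite op set \<Rightarrow> 'n op endo set" where
  "channel_endos S = Rep_endo -` channel_closure S"

lemma channel_class_closure: "channel_class S (channel_closure S)"
  unfolding channel_closure_def channel_class_def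
  by (intro conjI closed_Inter convex_Inter) (auto simp: channel_class_def)

lemma closed_channel_endos: "closed (channel_endos S)"
  unfolding channel_endos_def
  using channel_class_closure[of S]
  by (intro closed_vimage linear_continuous_on bounded_linear_Rep_endo)
    (auto simp: channel_class_def intro!: continuous_at_imp_continuous_on bounded_linear.isCont[OF bounded_linear_Rep_endo])

lemma mult_channel_endos: "x \<in> channel_endos S \<Longrightarrow> y \<in> channel_endos S \<Longrightarrow> x * y \<in> channel_endos S"
  using channel_class_closure[of S] by (simp add: channel_endos_def channel_class_def times_endo.rep_eq)

lemma jump_channel_endos:
  assumes "a \<in> S" "t \<ge> 0"
  shows "exp (t *\<^sub>R Abs_endo (jump_generator a)) \<in> channel_endos S"
  using channel_class_closure[of S] assms
  by (simp add: channel_endos_def channel_class_def Rep_endo_exp scaleR_endo.rep_eq Abs_endo_inverse)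

lemma exp_ad_channel_endos_nonneg:
  assumes "A \<in> cspan S" "anti_hermitian A" "t \<ge> 0"
  shows "exp (t *\<^sub>R ad A) \<in> channel_endos S"
proof -
  have "A = cscale \<i> (cscale (- \<i>) A)" by simp
  then have "two_sided_mult (op_exp (t *\<^sub>R A)) (op_exp (- (t *\<^sub>R A))) \<in> channel_closure S"
    using channel_class_closure[of S] assms unfolding channel_class_def by metis
  then show ?thesis
    using exp_ad[of "t *\<^sub>R A"] by (simp add: channel_endos_def ad_scaleR Rep_sandwich)
qed

text \<open>Evolution backwards in time under \<open>A\<close> is evolution forwards under
  \<open>- A\<close>, which again lies in the span.\<close>

lemma exp_ad_channel_endos:
  assumes "A \<in> cspan S" "anti_hermitian A"
  shows "exp (t *\<^sub>R ad A) \<in> channel_endos S"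
proof (cases "t \<ge> 0")
  case False
  have "- A \<in> cspan S" "anti_hermitian (- A)"
    using assms by (auto simp: cop.span_neg anti_hermitian_def adj_uminus)
  from exp_ad_channel_endos_nonneg[OF this, of "- t"] False show ?thesis
    using ad_scaleR[of "- 1" A] by simp
qed (use exp_ad_channel_endos_nonneg[OF assms] in simp)

text \<open>The identity is the evolution under the zero Hamiltonian, and every span contains
  0.\<close>

lemma one_channel_endos: "1 \<in> channel_endos S"
  using exp_ad_channel_endos[of 0 S 0] by (simp add: cop.span_zero anti_hermitian_def vec_eq_iff adj_nth)

lemma exp_ad_su_channel_endos:
  assumes "hormander_system S" "B \<in> su"
  shows "exp (t *\<^sub>R ad B) \<in> channel_endos S"
proof -
  let ?G = "group_generators (channel_endos S)"
  note semigroup = closed_channel_endos[of S] one_channel_endos[of S] mult_channel_endos[of _ S]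
  define L where "L = {A. ad A \<in> ?G}"
  have "real_lie_algebra L"
    unfolding real_lie_algebra_def subspace_def L_def
    by (auto simp: ad_add ad_scaleR ad_zero ad_commutator
        intro: group_generators_add[OF semigroup] group_generators_scaleR[OF semigroup] 
          group_generators_commutator[OF semigroup])
      (simp add: group_generators_def[OF semigroup] one_channel_endos)
  moreover have "{A \<in> cspan S. anti_hermitian A} \<subseteq> L"
    by (auto simp: L_def group_generators_def[OF semigroup] exp_ad_channel_endos)
  ultimately have "real_lie_algebra hull {A \<in> cspan S. anti_hermitian A} \<subseteq> L"
    by (intro hull_minimal)
  then show ?thesis
    using assms by (auto simp: hormander_system_def L_def group_generators_def[OF semigroup])
qed

text \<open>For a Hermitian involution \<open>V\<close>, conjugation by \<open>V\<close> is conjugation by \<open>exp (\<pi> i V / 2) = i V\<close>.\<close>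

lemma reflection_channel_endos:
  assumes "hormander_system S" "hermitian V" "V ** V = mat 1"
  shows "sandwich V V \<in> channel_endos S"
proof -
  let ?iV = "cscale \<i> V"
  \<comment> \<open>Subtracting \<open>\<i> * c\<close> times the identity makes \<open>?iV\<close>
    traceless. As \<open>V\<close> is Hermitian, \<open>c\<close> is real, so the difference stays
    anti-Hermitian.\<close>
  define c where "c = trace V / of_nat CARD('a)"
  \<comment> \<open>The left and right halves of \<open>ad ?iV\<close>: commuting square roots of
    \<open>- 1\<close>, each equal to its own exponential at time \<open>pi / 2\<close>. In
    \<open>J * K\<close> the scalars \<open>\<i>\<close> and \<open>- \<i>\<close> cancel.\<close>
  define J K where "J = sandwich ?iV (mat 1)" and "K = sandwich (mat 1) (- ?iV)"
  have iV2: "?iV ** ?iV = - mat 1"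
    using assms(3) by (simp add: cscale_minus_one)
  have "J * J = - 1" "K * K = - 1"
    using iV2 by (simp_all add: J_def K_def sandwich_mult sandwich_one[symmetric] op_mult.minus_left op_mult.minus_right
        sandwich.minus_left sandwich.minus_right)
  then have "exp ((pi / 2) *\<^sub>R J) = J" "exp ((pi / 2) *\<^sub>R K) = K"
    by (simp_all add: exp_half_pi_square_root_minus_one)
  moreover have "J * K = K * J"
    by (simp add: J_def K_def sandwich_mult)
  ultimately have "exp ((pi / 2) *\<^sub>R (J + K)) = J * K"
    by (simp add: scaleR_add_right exp_add_commuting)
  also have "J * K = sandwich V V"
    by (rule endo_eqI) (simp add: J_def K_def sandwich_mult endo_apply_simps op_mult.minus_right cscale_minus_one)
  also have "J + K = ad ?iV"
    by (simp add: J_def K_def ad_def sandwich.minus_right)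
  also have "ad ?iV = ad (?iV - cscale (\<i> * c) (mat 1))"
    by (simp add: ad_diff ad_scalar)
  finally have eq: "exp ((pi / 2) *\<^sub>R ad (?iV - cscale (\<i> * c) (mat 1))) = sandwich V V" .
  have "adj V = V" using assms(2) by (simp add: hermitian_def)
  then have "V $ x $ x = cnj (V $ x $ x)" for x by (metis adj_nth)
  then have "cnj c = c" by (simp add: c_def trace_def)
  then have "?iV - cscale (\<i> * c) (mat 1) \<in> su"
    using \<open>adj V = V\<close>
    by (auto simp: su_def anti_hermitian_def adj_diff adj_cscale adj_one)
      (simp_all add: vec_eq_iff cscale_def map_matrix_def trace_def c_def mat_def sum_subtractf sum_distrib_left[symmetric])
  from exp_ad_su_channel_endos[OF assms(1) this, of "pi / 2"] eq show ?thesis by simp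
qed

section \<open>Resetting qubits\<close>

text \<open>With \<open>p = a\<^sup>* a\<close> and \<open>q = 1 - p\<close> the generator is \<open>- Q1 - 2 Q2\<close> for the commuting idempotents
  \<open>Q1 \<rho> = p \<rho> q + q \<rho> p\<close> and \<open>Q2 \<rho> = p \<rho> p - a \<rho> a\<^sup>*\<close>, so its semigroup tends to \<open>(1 - Q1) (1 - Q2)\<close>.\<close>

lemma jump_limit_channel_endos:
  assumes "a \<in> S" "a ** a = 0" "a ** adj a ** a = a"
  defines "q \<equiv> mat 1 - adj a ** a"
  shows "sandwich q q + sandwich a (adj a) \<in> channel_endos S"
proof -
  \<comment> \<open>The hypotheses make \<open>a\<close> a partial isometry whose range lies in the
    kernel of the projection \<open>p\<close>.\<close>
  define p where "p = adj a ** a"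
  have adj_nilpotent: "adj a ** adj a = 0"
    using adj_mult[of a a] assms(2) by (simp add: vec_eq_iff adj_nth)
  have adj_isometry: "adj a ** a ** adj a = adj a"
    using arg_cong[OF assms(3), of adj] by (simp add: adj_mult adj_adj matrix_mul_assoc)
  have p: "p ** p = p" "p ** a = 0" "a ** p = a" "adj a ** p = 0" "p ** adj a = adj a"
    using assms(2,3) adj_nilpotent adj_isometry
    by (simp_all add: p_def matrix_mul_assoc op_mult.zero_left) (simp_all add: matrix_mul_assoc[symmetric] op_mult.zero_right)
  have q: "p ** q = 0" "q ** p = 0" "q ** q = q" "q ** a = a" "a ** q = 0" "adj a ** q = adj a" "q ** adj a = 0"
    using p by (simp_all add: q_def p_def[symmetric] op_mult.diff_left op_mult.diff_right)
  define Q1 Q2 where "Q1 = sandwich p q + sandwich q p" and "Q2 = sandwich p p - sandwich a (adj a)"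
  note mult_simps = algebra_simps sandwich_mult p q assms(2) adj_nilpotent sandwich.zero_left sandwich.zero_right
  have idem: "Q1 * Q1 = Q1" "Q2 * Q2 = Q2" "Q1 * Q2 = 0" "Q2 * Q1 = 0"
    by (simp_all add: Q1_def Q2_def mult_simps)
  \<comment> \<open>Splitting \<rho> on both sides gives four blocks. The off-diagonal two form
    \<open>Q1\<close>; hence \<open>1 - Q1 - Q2\<close> keeps the \<open>q\<close>-block and
    transports the \<open>p\<close>-block by \<open>a\<close>.\<close>
  have "mat 1 = p + q" by (simp add: p_def q_def)
  then have one: "1 = Q1 + (sandwich p p + sandwich q q)"
    unfolding sandwich_one[symmetric] Q1_def by (simp add: sandwich.add_left sandwich.add_right algebra_simps)
  \<comment> \<open>Coherences between \<open>p\<close> and \<open>q\<close> decay at rate 1, the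
    \<open>p\<close>-block at rate 2.\<close>
  have gen: "Abs_endo (jump_generator a) = - Q1 - 2 *\<^sub>R Q2"
  proof (rule endo_eqI)
    fix \<rho>
    have "blinfun_apply (Rep_endo (Abs_endo (jump_generator a))) \<rho> = 2 *\<^sub>R (a ** \<rho> ** adj a) - p ** \<rho> - \<rho> ** p"
      by (simp add: Abs_endo_inverse jump_generator.rep_eq p_def matrix_mul_assoc)
    then show "blinfun_apply (Rep_endo (Abs_endo (jump_generator a))) \<rho> = blinfun_apply (Rep_endo (- Q1 - 2 *\<^sub>R Q2)) \<rho>"
      by (simp add: Q1_def Q2_def q_def p_def[symmetric] endo_apply_simps op_mult.diff_left op_mult.diff_right
          scaleR_2 matrix_mul_assoc)
  qed
  have exp: "exp (t *\<^sub>R Abs_endo (jump_generator a)) = (1 + (exp (- t) - 1) *\<^sub>R Q1) * (1 + (exp (- 2 * t) - 1) *\<^sub>R Q2)" for t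
  proof -
    have "exp (t *\<^sub>R Abs_endo (jump_generator a)) = exp ((- t) *\<^sub>R Q1 + (- 2 * t) *\<^sub>R Q2)"
      by (simp add: gen algebra_simps)
    also have "\<dots> = exp ((- t) *\<^sub>R Q1) * exp ((- 2 * t) *\<^sub>R Q2)"
      by (intro exp_add_commuting) (simp add: idem)
    finally show ?thesis
      by (simp only: exp_scaleR_idempotent idem)
  qed
  have "(1 - Q1) * (1 - Q2) = 1 - Q1 - Q2"
    by (simp add: algebra_simps idem)
  then have lim: "(1 + (0 - 1) *\<^sub>R Q1) * (1 + (0 - 1) *\<^sub>R Q2) = sandwich q q + sandwich a (adj a)"
    unfolding one by (simp add: Q2_def)
  have "filterlim (\<lambda>n. c * real n) at_top sequentially" if "c > 0" for c
    by (rule filterlim_tendsto_pos_mult_at_top[OF tendsto_const that filterlim_real_sequentially])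
  from this[of 1] this[of 2] have "(\<lambda>n. exp (- real n)) \<longlonglongrightarrow> 0" "(\<lambda>n. exp (- 2 * real n)) \<longlonglongrightarrow> 0"
    by (auto intro!: filterlim_compose[OF exp_at_bot] simp: filterlim_uminus_at_bot)
  then have "(\<lambda>n. exp (real n *\<^sub>R Abs_endo (jump_generator a))) \<longlonglongrightarrow> sandwich q q + sandwich a (adj a)"
    unfolding exp lim[symmetric] by (intro tendsto_intros)
  then show ?thesis
    by (rule closed_sequentially[OF closed_channel_endos, rotated]) (simp add: jump_channel_endos assms(1))
qed

section \<open>Matrix entries of the lowering operator and of the first-qubit reset\<close>

lemma two_neq_zero_iff: "(i::2) \<noteq> 0 \<longleftrightarrow> i = 1"
  using exhaust_2[of i] by auto

lemma lower_first_nth: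
  fixes x y :: "'k::{finite, linorder} bits"
  shows "lower_first $ x $ y = (if x (Min UNIV) = 0 \<and> y = x(Min UNIV := 1) then 1 else 0)"
proof (cases "x (Min UNIV) = 0 \<and> y = x(Min UNIV := 1)")
  case True
  then have "lower_first $ x $ y = (\<Prod>i\<in>(UNIV::'k set). 1)"
    unfolding lower_first_def tensor_def vec_lambda_beta
    by (intro prod.cong) (auto simp: ketbra_def axis_def mat_def)
  then show ?thesis using True by simp
next
  case False
  \<comment> \<open>One vanishing factor kills the product: the first one if \<open>x\<close> starts
    with 1, otherwise the one at a position where \<open>y\<close> differs from the flipped
    \<open>x\<close>.\<close>
  have "\<exists>i. (if i = Min UNIV then ketbra 0 1 else mat 1) $ x i $ y i = 0"
  proof (cases "x (Min UNIV) = 0")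
    case True
    with False obtain i where "y i \<noteq> (x(Min UNIV := 1)) i" by (auto simp: fun_eq_iff)
    then show ?thesis by (intro exI[of _ i]) (auto simp: ketbra_def axis_def mat_def split: if_splits)
  qed (auto intro!: exI[of _ "Min UNIV"] simp: ketbra_def axis_def)
  then obtain i where "(if i = Min UNIV then ketbra 0 1 else mat 1) $ x i $ y i = 0" ..
  then have "lower_first $ x $ y = 0"
    unfolding lower_first_def tensor_def vec_lambda_beta by (intro prod_zero bexI[of _ i]) simp_all
  then show ?thesis using False by simp
qed

lemma lower_first_mult_nth:
  "(lower_first ** R) $ x $ y = (if x (Min UNIV) = 0 then R $ x(Min UNIV := 1) $ y else 0)"
  by (auto simp: matrix_matrix_mult_def lower_first_nth if_distrib[of "\<lambda>c. c * _"] sum.delta cong: if_cong)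

lemma mult_adj_lower_first_nth:
  "(R ** adj lower_first) $ x $ y = (if y (Min UNIV) = 0 then R $ x $ y(Min UNIV := 1) else 0)"
  by (auto simp: matrix_matrix_mult_def adj_nth lower_first_nth if_distrib[of cnj] if_distrib[of "\<lambda>c. _ * c"] sum.delta cong: if_cong)

lemma adj_lower_first_mult_lower_first_nth:
  "(adj lower_first ** lower_first) $ x $ y = (if x (Min UNIV) = 1 \<and> y = x then 1 else 0)"
proof -
  \<comment> \<open>The only intermediate string that can contribute is \<open>x\<close> with its
    first bit cleared.\<close>
  have "cnj (lower_first $ z $ x) * lower_first $ z $ y =
      (if z = x(Min UNIV := 0) then (if x (Min UNIV) = 1 \<and> y = x then 1 else 0) else 0)" for z
  proof (cases "z (Min UNIV) = 0 \<and> x = z(Min UNIV := 1)")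
    case True
    then show ?thesis by (auto simp: lower_first_nth)
  next
    case False
    then have "\<not> (z = x(Min UNIV := 0) \<and> x (Min UNIV) = 1)"
      by (metis fun_upd_same fun_upd_triv fun_upd_upd)
    then show ?thesis using False by (auto simp: lower_first_nth)
  qed
  then show ?thesis
    unfolding matrix_matrix_mult_def vec_lambda_beta adj_nth by simp
qed

lemma diagonal_projection_mult_nth:
  assumes "\<And>x y. Q $ x $ y = (if x = y \<and> P x then 1 else 0)"
  shows "(Q ** R) $ x $ y = (if P x then R $ x $ y else 0)" "(R ** Q) $ x $ y = (if P y then R $ x $ y else 0)"
proof -
  have "(Q ** R) $ x $ y = (\<Sum>z\<in>UNIV. if z = x then (if P x then R $ x $ y else 0) else 0)"
    unfolding matrix_matrix_mult_def vec_lambda_beta assms by (intro sum.cong) auto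
  then show "(Q ** R) $ x $ y = (if P x then R $ x $ y else 0)" by simp
  have "(R ** Q) $ x $ y = (\<Sum>z\<in>UNIV. if z = y then (if P y then R $ x $ y else 0) else 0)"
    unfolding matrix_matrix_mult_def vec_lambda_beta assms by (intro sum.cong) auto
  then show "(R ** Q) $ x $ y = (if P y then R $ x $ y else 0)" by simp
qed

definition unexcited_first :: "'k::{finite, linorder} bits op" where
  "unexcited_first = mat 1 - adj lower_first ** lower_first"

lemma unexcited_first_nth: "unexcited_first $ x $ y = (if x = y \<and> x (Min UNIV) = 0 then 1 else 0)"
  using two_neq_zero_iff[of "x (Min UNIV)"]
  by (auto simp: unexcited_first_def adj_lower_first_mult_lower_first_nth mat_def)

text \<open>The Kraus form of the map that traces out the first qubit and prepares it in the basis
  state 0.\<close>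

definition reset_first :: "'k::{finite, linorder} bits op endo" where
  "reset_first = sandwich unexcited_first unexcited_first + sandwich lower_first (adj lower_first)"

lemma reset_first_channel_endos:
  assumes "lower_first \<in> S"
  shows "reset_first \<in> channel_endos S"
  unfolding reset_first_def unexcited_first_def
  using assms
proof (rule jump_limit_channel_endos)
  show "lower_first ** lower_first = (0 :: 'a bits op)"
    by (auto simp: vec_eq_iff lower_first_mult_nth lower_first_nth)
  show "lower_first ** adj lower_first ** lower_first = (lower_first :: 'a bits op)"
    unfolding matrix_mul_assoc[symmetric]
    by (auto simp: vec_eq_iff lower_first_mult_nth adj_lower_first_mult_lower_first_nth lower_first_nth)
qed

lemma reset_first_nth:
  "blinfun_apply (Rep_endo reset_first) \<rho> $ x $ y =
    (if x (Min UNIV) = 0 \<and> y (Min UNIV) = 0 then \<rho> $ x $ y + \<rho> $ x(Min UNIV := 1) $ y(Min UNIV := 1) else 0)"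
  by (simp add: reset_first_def endo_apply_simps mult_adj_lower_first_nth lower_first_mult_nth
      diagonal_projection_mult_nth[OF unexcited_first_nth])

text \<open>By cyclicity the two Kraus terms have the traces of \<open>q ** \<rho>\<close> and
  \<open>(mat 1 - q) ** \<rho>\<close>, where \<open>q\<close> is
  \<open>unexcited_first\<close>.\<close>

lemma trace_reset_first: "trace (blinfun_apply (Rep_endo reset_first) \<rho>) = trace \<rho>"
  for \<rho> :: "'k::{finite, linorder} bits op"
proof -
  have "unexcited_first ** unexcited_first = (unexcited_first :: 'k bits op)"
    by (simp add: vec_eq_iff diagonal_projection_mult_nth[OF unexcited_first_nth] unexcited_first_nth)
  then have "trace (unexcited_first ** \<rho> ** unexcited_first) = trace (unexcited_first ** \<rho>)"
    using trace_mul_sym[of "unexcited_first ** \<rho>" unexcited_first] by (simp add: matrix_mul_assoc)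
  moreover have "trace (lower_first ** \<rho> ** adj lower_first) = trace (adj lower_first ** lower_first ** \<rho>)"
    using trace_mul_sym[of "lower_first ** \<rho>" "adj lower_first"] by (simp add: matrix_mul_assoc)
  ultimately show ?thesis
    by (simp add: reset_first_def endo_apply_simps trace_add unexcited_first_def op_mult.diff_left trace_sub)
qed

section \<open>Qubit swaps and the reset of all qubits\<close>

definition perm_op :: "('n::finite \<Rightarrow> 'n) \<Rightarrow> 'n op" where
  "perm_op f = (\<chi> x y. if y = f x then 1 else 0)"

context
  fixes f :: "'n::finite \<Rightarrow> 'n"
  assumes invol: "f (f x) = x"
begin

lemma hermitian_perm_op: "hermitian (perm_op f)"
  by (auto simp: hermitian_def vec_eq_iff adj_nth perm_op_def invol)

lemma perm_op_mult_nth: "(perm_op f ** R) $ x $ y = R $ f x $ y"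
  by (simp add: matrix_matrix_mult_def perm_op_def if_distrib[of "\<lambda>c. c * _"] cong: if_cong)

lemma mult_perm_op_nth: "(R ** perm_op f) $ x $ y = R $ x $ f y"
proof -
  have "(R ** perm_op f) $ x $ y = (\<Sum>z\<in>UNIV. if z = f y then R $ x $ f y else 0)"
    unfolding matrix_matrix_mult_def perm_op_def vec_lambda_beta by (intro sum.cong) (auto simp: invol)
  then show ?thesis by simp
qed

lemma perm_op_involution: "perm_op f ** perm_op f = mat 1"
  unfolding vec_eq_iff perm_op_mult_nth by (auto simp: perm_op_def mat_def invol)

end

text \<open>For \<open>j = Min UNIV\<close> both updates write the old value, so the swap
  degenerates to the identity and the first qubit is treated like the others.\<close>

definition swap_first :: "'k \<Rightarrow> 'k::{finite, linorder} bits \<Rightarrow> 'k bits" where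
  "swap_first j x = x(Min UNIV := x j, j := x (Min UNIV))"

lemma swap_first_swap_first: "swap_first j (swap_first j x) = x"
  by (auto simp: swap_first_def fun_eq_iff)

text \<open>The invariant records just the trace and the forced zeros, because for
  \<open>J = UNIV\<close> these two determine the map.\<close>

lemma exists_reset:
  fixes S :: "'k::{finite, linorder} bits op set"
  assumes "hormander_system S" "lower_first \<in> S" "finite J"
  shows "\<exists>\<Phi>\<in>channel_endos S. \<forall>\<rho>. trace (blinfun_apply (Rep_endo \<Phi>) \<rho>) = trace \<rho> \<and>
    (\<forall>x y. (\<exists>j\<in>J. x j \<noteq> 0 \<or> y j \<noteq> 0) \<longrightarrow> blinfun_apply (Rep_endo \<Phi>) \<rho> $ x $ y = 0)"
  using assms(3)
proof induction
  case empty
  then show ?case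
    by (intro bexI[OF _ one_channel_endos]) (simp add: one_endo.rep_eq)
next
  case (insert j J)
  then obtain \<Phi> where \<Phi>: "\<Phi> \<in> channel_endos S" "\<And>\<rho>. trace (blinfun_apply (Rep_endo \<Phi>) \<rho>) = trace \<rho>"
    "\<And>\<rho> x y i. i \<in> J \<Longrightarrow> x i \<noteq> 0 \<or> y i \<noteq> 0 \<Longrightarrow> blinfun_apply (Rep_endo \<Phi>) \<rho> $ x $ y = 0"
    by blast
  define V where "V = perm_op (swap_first j)"
  have V: "hermitian V" "V ** V = mat 1"
    unfolding V_def by (simp_all add: hermitian_perm_op perm_op_involution swap_first_swap_first)
  have VV: "blinfun_apply (Rep_endo (sandwich V V)) \<rho> $ x $ y = \<rho> $ swap_first j x $ swap_first j y" for \<rho> x y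
    unfolding V_def by (simp add: endo_apply_simps perm_op_mult_nth mult_perm_op_nth swap_first_swap_first)
  define R where "R = sandwich V V * reset_first * sandwich V V"
  have "sandwich V V \<in> channel_endos S"
    using reflection_channel_endos[OF assms(1) V] .
  then have "R * \<Phi> \<in> channel_endos S"
    unfolding R_def by (intro mult_channel_endos reset_first_channel_endos assms \<Phi>)
  moreover have "trace (blinfun_apply (Rep_endo (R * \<Phi>)) \<rho>) = trace \<rho>" for \<rho>
  proof -
    have "trace (V ** \<rho> ** V) = trace \<rho>" for \<rho>
      using trace_mul_sym[of "V ** \<rho>" V] by (simp add: matrix_mul_assoc V)
    then show ?thesis
      by (simp add: R_def endo_apply_simps trace_reset_first \<Phi>)
  qed
  moreover have "blinfun_apply (Rep_endo (R * \<Phi>)) \<rho> $ x $ y = 0"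
    if i: "i \<in> insert j J" "x i \<noteq> 0 \<or> y i \<noteq> 0" for \<rho> x y i
  proof -
    have upd: "swap_first j ((swap_first j x)(Min UNIV := 1)) = x(j := 1)" for x
      by (auto simp: swap_first_def fun_eq_iff)
    have first: "swap_first j x (Min UNIV) = x j" for x
      by (simp add: swap_first_def)
    \<comment> \<open>Only the \<open>j\<close>-th bits are altered. Since \<open>j\<close> is not
      in \<open>J\<close>, the zeros forced by \<open>\<Phi>\<close> survive.\<close>
    have "blinfun_apply (Rep_endo R) \<rho> $ x $ y = 
        (if x j = 0 \<and> y j = 0 then \<rho> $ x $ y + \<rho> $ x(j := 1) $ y(j := 1) else 0)" for \<rho>
      unfolding R_def times_endo.rep_eq blinfun_apply_blinfun_compose VV reset_first_nth upd first swap_first_swap_first ..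
    then show ?thesis
      using i insert.hyps by (auto simp: times_endo.rep_eq \<Phi>(3)[of i])
  qed
  ultimately show ?case by blast
qed

text \<open>After all resets only the entry at the all-zero string can be nonzero, and trace
  preservation makes it \<open>trace \<rho>\<close>.\<close>

lemma replacer_basis_channel_endos:
  fixes S :: "'k::{finite, linorder} bits op set"
  assumes "hormander_system S" "lower_first \<in> S"
  shows "\<exists>z. Abs_endo (replacer (\<chi> x y. if x = z \<and> y = z then 1 else 0)) \<in> channel_endos S"
proof -
  obtain \<Phi> where \<Phi>: "\<Phi> \<in> channel_endos S" "\<And>\<rho>. trace (blinfun_apply (Rep_endo \<Phi>) \<rho>) = trace \<rho>"
    "\<And>\<rho> x y i. x i \<noteq> 0 \<or> y i \<noteq> 0 \<Longrightarrow> blinfun_apply (Rep_endo \<Phi>) \<rho> $ x $ y = 0"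
    using exists_reset[OF assms finite[of UNIV]] by blast
  let ?z = "\<lambda>_. 0 :: 2"
  have zero: "blinfun_apply (Rep_endo \<Phi>) \<rho> $ x $ y = 0" if "\<not> (x = ?z \<and> y = ?z)" for \<rho> x y
    using that \<Phi>(3) by (metis ext)
  have "trace \<rho> = blinfun_apply (Rep_endo \<Phi>) \<rho> $ ?z $ ?z" for \<rho>
  proof -
    have "trace \<rho> = (\<Sum>x\<in>UNIV. blinfun_apply (Rep_endo \<Phi>) \<rho> $ x $ x)"
      using \<Phi>(2) by (simp add: trace_def)
    also have "\<dots> = (\<Sum>x\<in>{?z}. blinfun_apply (Rep_endo \<Phi>) \<rho> $ x $ x)"
      by (intro sum.mono_neutral_right) (auto simp: zero)
    finally show ?thesis by simp
  qed
  then have "\<Phi> = Abs_endo (replacer (\<chi> x y. if x = ?z \<and> y = ?z then 1 else 0))"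
    by (intro endo_eqI)
      (auto simp: Abs_endo_inverse replacer.rep_eq cscale_def map_matrix_def vec_eq_iff zero)
  then show ?thesis using \<Phi>(1) by blast
qed

section \<open>Pure states\<close>

definition outer :: "complex ^ 'n::finite \<Rightarrow> 'n op" where
  "outer v = (\<chi> x y. v $ x * cnj (v $ y))"

lemma adj_outer: "adj (outer v) = outer v"
  by (simp add: vec_eq_iff adj_nth outer_def)

lemma cinner_diff_left: "cinner (u - v) w = cinner u w - cinner v w"
  and cinner_diff_right: "cinner u (v - w) = cinner u v - cinner u w"
  and cinner_scale_left: "cinner (c *s u) v = cnj c * cinner u v"
  and cinner_scale_right: "cinner u (c *s v) = c * cinner u v"
  and cnj_cinner: "cnj (cinner u v) = cinner v u"
  by (simp_all add: cinner_def algebra_simps sum_subtractf sum_distrib_left)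

lemma cinner_axis_left: "cinner (axis i 1) v = v $ i"
  by (simp add: cinner_def axis_def if_distrib[of cnj] if_distrib[of "\<lambda>c. c * _"] cong: if_cong)

lemma cinner_self: "cinner v v = of_real ((norm v)\<^sup>2)"
  by (simp add: cinner_def norm_vec_def L2_set_def sum_nonneg mult.commute[of "cnj _"]
      flip: complex_norm_square)

lemma cinner_mult_right: "cinner u (A *v v) = cinner (adj A *v u) v"
proof -
  have "cinner u (A *v v) = (\<Sum>x\<in>UNIV. \<Sum>y\<in>UNIV. cnj (u $ x) * (A $ x $ y * v $ y))"
    by (simp add: cinner_def matrix_vector_mult_def sum_distrib_left)
  also have "\<dots> = (\<Sum>y\<in>UNIV. \<Sum>x\<in>UNIV. cnj (u $ x) * (A $ x $ y * v $ y))"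
    by (rule sum.swap)
  also have "\<dots> = cinner (adj A *v u) v"
    by (simp add: cinner_def matrix_vector_mult_def sum_distrib_left adj_nth mult_ac)
  finally show ?thesis .
qed

lemma outer_mult_vector: "outer w *v v = cinner w v *s w"
  by (simp add: vec_eq_iff outer_def matrix_vector_mult_def cinner_def sum_distrib_left mult_ac)

lemma mult_axis_nth: "(A *v axis i 1) $ x = A $ x $ i" for A :: "'n::finite op"
  by (simp add: matrix_vector_mult_def axis_def if_distrib[of "\<lambda>c. _ * c"] cong: if_cong)

lemma mult_outer_adj: "A ** outer v ** adj A = outer (A *v v)"
proof -
  have *: "(A ** outer v) $ x $ y = (A *v v) $ x * cnj (v $ y)" for x y
    by (simp add: matrix_matrix_mult_def outer_def matrix_vector_mult_def sum_distrib_right mult.assoc)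
  have "(A ** outer v ** adj A) $ x $ y = (\<Sum>k\<in>UNIV. (A *v v) $ x * (cnj (v $ k) * cnj (A $ y $ k)))" for x y
    unfolding matrix_matrix_mult_def[of "A ** outer v"] vec_lambda_beta * adj_nth by (simp only: mult.assoc)
  also have "\<dots> x y = outer (A *v v) $ x $ y" for x y
    unfolding sum_distrib_left[symmetric] by (simp add: outer_def matrix_vector_mult_def mult.commute)
  finally show ?thesis by (simp add: vec_eq_iff)
qed

lemma outer_mult_outer: "outer w ** outer w = cscale (cinner w w) (outer w)"
  by (simp add: vec_eq_iff outer_def matrix_matrix_mult_def cinner_def cscale_def map_matrix_def
      sum_distrib_right sum_distrib_left mult_ac)

lemma outer_scaleR: "outer (r *\<^sub>R v) = r\<^sup>2 *\<^sub>R outer v"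
  by (simp add: vec_eq_iff outer_def power2_eq_square)

lemma outer_phase:
  assumes "cnj c * c = 1"
  shows "outer (c *s v) = outer v"
proof -
  have "c * a * (cnj c * b) = (cnj c * c) * (a * b)" for a b by (simp add: mult_ac)
  then show ?thesis by (simp add: vec_eq_iff outer_def assms)
qed

text \<open>The Householder reflection in the hyperplane orthogonal to \<open>u - v\<close>.\<close>

lemma reflection_exists:
  assumes u: "cinner u u = 1" and v: "cinner v v = 1" and real: "cinner u v \<in> \<real>"
  obtains V where "hermitian V" "V ** V = mat 1" "V *v u = v"
proof (cases "u = v")
  case True
  then show ?thesis using that[of "mat 1"] by (simp add: hermitian_def adj_one)
next
  case False
  define w where "w = u - v"
  have vu: "cinner v u = cinner u v"
    using real cnj_cinner[of u v] by (metis Reals_cnj_iff)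
  \<comment> \<open>Realness makes \<open>cinner w w\<close> exactly twice
    \<open>cinner w u\<close>; therefore the reflection subtracts exactly \<open>w\<close> from
    \<open>u\<close>, which leaves \<open>v\<close>.\<close>
  have ww: "cinner w w = 2 - 2 * cinner u v" and wu: "cinner w u = 1 - cinner u v"
    by (simp_all add: w_def cinner_diff_left cinner_diff_right u v vu)
  have N: "cinner w w \<noteq> 0" "cnj (cinner w w) = cinner w w"
    using False by (simp_all add: w_def cinner_self)
  define c where "c = 2 / cinner w w"
  have c: "cnj c = c" "c * cinner w w = 2" using N by (simp_all add: c_def)
  define V where "V = mat 1 - cscale c (outer w)"
  have "adj V = V" by (simp add: V_def adj_diff adj_one adj_cscale adj_outer c)
  moreover have "V ** V = mat 1"
  proof -
    have "cscale c (outer w) ** cscale c (outer w) = cscale c (cscale 2 (outer w))"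
      by (simp add: outer_mult_outer c)
    also have "\<dots> = cscale c (outer w) + cscale c (outer w)"
      by (simp add: vec_eq_iff cscale_def map_matrix_def)
    finally show ?thesis
      by (simp add: V_def op_mult.diff_left op_mult.diff_right del: cscale_mult)
  qed
  moreover have "V *v u = v"
  proof -
    have "cscale c (outer w) *v u = c *s (outer w *v u)"
      by (simp add: vec_eq_iff cscale_def map_matrix_def matrix_vector_mult_def sum_distrib_left mult_ac)
    also have "\<dots> = (c * cinner w u) *s w" by (simp add: outer_mult_vector)
    also have "c * cinner w u = c * cinner w w / 2" by (simp add: ww wu field_simps)
    also have "\<dots> = 1" by (simp add: c)
    finally show ?thesis by (simp add: V_def matrix_vector_mult_diff_rdistrib w_def)
  qed
  ultimately show ?thesis using that[of V] by (simp add: hermitian_def)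
qed

text \<open>Cholesky decomposition: subtracting the rank-one operator built from the \<open>i\<close>-th column clears the \<open>i\<close>-th row
  and keeps the operator positive.\<close>

lemma positive_op_sum_outer:
  assumes "finite I" "hermitian A" "positive_op A" "\<And>x y. x \<notin> I \<Longrightarrow> A $ x $ y = 0"
  shows "\<exists>v. A = (\<Sum>i\<in>I. outer (v i))"
  using assms
proof (induction I arbitrary: A)
  case empty
  then show ?case by (simp add: vec_eq_iff)
next
  case (insert i I)
  have herm: "adj A = A" using insert.prems(1) by (simp add: hermitian_def)
  then have cnj: "cnj (A $ x $ y) = A $ y $ x" for x y by (metis adj_nth)
  define e :: "complex ^ 'a" where "e = axis i 1"
  have e: "cinner e v = v $ i" "cinner v e = cnj (v $ i)" for v
    using cnj_cinner[of e v] by (auto simp: e_def cinner_axis_left)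
  have Ae: "(A *v e) $ x = A $ x $ i" for x
    by (simp add: e_def mult_axis_nth)
  \<comment> \<open>The quadratic form along the line through \<open>v\<close> in direction
    \<open>e\<close>. It serves both cases: to refute a nonzero entry beside a zero pivot, and to
    complete the square for a positive pivot.\<close>
  have expand: "cinner (v - s *s e) (A *v (v - s *s e)) =
      cinner v (A *v v) - cnj s * (A *v v) $ i - s * cnj ((A *v v) $ i) + s * cnj s * A $ i $ i" for v s
  proof -
    have "cinner v (A *v e) = cnj ((A *v v) $ i)"
      by (simp add: cinner_mult_right[of v A e] herm e)
    then show ?thesis
      by (simp add: matrix_vector_mult_diff_distrib vector_scalar_commute cinner_diff_left cinner_diff_right
          cinner_scale_left cinner_scale_right e Ae algebra_simps)
  qed
  have pos: "0 \<le> Re (cinner v (A *v v))" "Im (cinner v (A *v v)) = 0" for v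
    using insert.prems(2) by (auto simp: positive_op_def complex_nonneg_Reals_iff)
  define d where "d = Re (A $ i $ i)"
  have d: "A $ i $ i = of_real d" "d \<ge> 0"
    using pos[of e] by (auto simp: e Ae d_def complex_eq_iff)
  show ?case
  proof (cases "d = 0")
    case True
    have "A $ i $ j = 0" for j
    proof (rule ccontr)
      assume nz: "A $ i $ j \<noteq> 0"
      \<comment> \<open>With zero pivot the form is affine in \<open>t\<close> along this line; this
        \<open>t\<close> gives it the value \<open>- 1\<close>.\<close>
      define t where "t = (Re (A $ j $ j) + 1) / (2 * (cmod (A $ i $ j))\<^sup>2)"
      have "0 \<le> Re (A $ j $ j) - 2 * t * (cmod (A $ i $ j))\<^sup>2"
        using pos(1)[of "axis j 1 - (of_real t * A $ i $ j) *s e"]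
        unfolding expand by (simp add: d True mult_axis_nth cinner_axis_left cmod_power2) (simp add: algebra_simps power2_eq_square)
      also have "\<dots> = - 1"
        using nz by (simp add: t_def field_simps)
      finally show False by simp
    qed
    then obtain v where v: "A = (\<Sum>i\<in>I. outer (v i))"
      using insert.IH[of A] insert.prems by (metis insert_iff)
    have "A = (\<Sum>k\<in>insert i I. outer ((v(i := 0)) k))"
    proof -
      have "outer (0 :: complex ^ 'a) = 0" by (simp add: outer_def vec_eq_iff)
      moreover have "(\<Sum>k\<in>I. outer ((v(i := 0)) k)) = (\<Sum>k\<in>I. outer (v k))"
        using insert.hyps by (intro sum.cong) auto
      ultimately show ?thesis using insert.hyps v by simp
    qed
    then show ?thesis by blast
  next
    case False
    then have "d > 0" using d by simp
    \<comment> \<open>The scaling makes \<open>outer u\<close> agree with \<open>A\<close> in row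
      \<open>i\<close>.\<close>
    define u where "u = inverse (sqrt d) *\<^sub>R (A *v e)"
    have u_nth: "outer u $ x $ y = A $ x $ i * A $ i $ y / of_real d" for x y
      using \<open>d > 0\<close> by (simp add: u_def outer_scaleR power_inverse) (simp add: outer_def Ae cnj divide_inverse scaleR_conv_of_real mult_ac)
    define B where "B = A - outer u"
    have "hermitian B"
      by (simp add: B_def hermitian_def adj_diff adj_outer herm)
    moreover have "positive_op B"
      unfolding positive_op_def
    proof
      fix v
      \<comment> \<open>The minimizer of the form along \<open>e\<close>; its minimum there is the
        form of \<open>B\<close> at \<open>v\<close>, hence nonnegative.\<close>
      define s where "s = (A *v v) $ i / of_real d"
      have "cinner v (outer u *v v) = s * cnj ((A *v v) $ i)"
      proof -
        have "cinner (A *v e) v = (A *v v) $ i"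
          using cinner_mult_right[of e A v] by (simp add: herm e)
        moreover have u: "u = of_real (inverse (sqrt d)) *s (A *v e)"
          unfolding u_def vec_eq_iff vector_scaleR_component vector_smult_component
          by (simp only: scaleR_conv_of_real simp_thms)
        ultimately have "cinner u v = inverse (of_real (sqrt d)) * (A *v v) $ i"
          by (simp add: cinner_scale_left)
        moreover have "cinner v u = cnj (cinner u v)" by (simp add: cnj_cinner)
        moreover have "inverse (complex_of_real (sqrt d)) * inverse (of_real (sqrt d)) = inverse (of_real d)"
          using \<open>d > 0\<close> by (simp flip: of_real_mult inverse_mult_distrib)
        ultimately show ?thesis
          by (simp add: outer_mult_vector cinner_scale_right s_def divide_inverse mult_ac)
      qed
      moreover have "s * cnj s * of_real d = cnj s * (A *v v) $ i"
        using \<open>d > 0\<close> by (simp add: s_def)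
      ultimately have "cinner v (B *v v) = cinner (v - s *s e) (A *v (v - s *s e))"
        unfolding expand by (simp add: B_def matrix_vector_mult_diff_rdistrib cinner_diff_right d)
      then show "cinner v (B *v v) \<in> \<real>\<^sub>\<ge>\<^sub>0"
        using insert.prems(2) by (simp add: positive_op_def)
    qed
    moreover have "B $ x $ y = 0" if "x \<notin> I" for x y
      using that insert.prems(3)[of x] \<open>d > 0\<close> by (cases "x = i") (auto simp: B_def u_nth d)
    ultimately obtain v where v: "B = (\<Sum>k\<in>I. outer (v k))"
      using insert.IH by blast
    have "(\<Sum>k\<in>I. outer ((v(i := u)) k)) = (\<Sum>k\<in>I. outer (v k))"
      using insert.hyps by (intro sum.cong) auto
    then have "A = (\<Sum>k\<in>insert i I. outer ((v(i := u)) k))"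
      using insert.hyps v by (simp add: B_def algebra_simps)
    then show ?thesis by blast
  qed
qed

section \<open>Replacers of pure and mixed states\<close>

definition replaceable :: "'n::finite op set \<Rightarrow> 'n op set" where
  "replaceable S = {\<sigma>. replacer \<sigma> \<in> channel_closure S}"

lemma convex_replaceable: "convex (replaceable S)" for S :: "'n::finite op set"
proof -
  have "linear (replacer :: 'n op \<Rightarrow> _)"
    by (intro linearI blinfun_eqI)
      (simp_all add: replacer.rep_eq blinfun.bilinear_simps cscale_def map_matrix_def vec_eq_iff algebra_simps)
  then have "convex (replacer -` channel_closure S)"
    using channel_class_closure[of S] by (intro convex_linear_vimage) (simp_all add: channel_class_def)
  then show ?thesis by (simp add: replaceable_def vimage_def)
qed

lemma reflection_replaceable:
  assumes "hormander_system S" "hermitian V" "V ** V = mat 1" "\<sigma> \<in> replaceable S"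
  shows "V ** \<sigma> ** V \<in> replaceable S"
proof -
  have "two_sided_mult V V o\<^sub>L replacer \<sigma> \<in> channel_closure S"
    using reflection_channel_endos[OF assms(1-3)] assms(4) channel_class_closure[of S]
    by (simp add: channel_endos_def Rep_sandwich replaceable_def channel_class_def)
  also have "two_sided_mult V V o\<^sub>L replacer \<sigma> = replacer (V ** \<sigma> ** V)"
    by (rule blinfun_eqI) (simp add: two_sided_mult.rep_eq replacer.rep_eq)
  finally show ?thesis by (simp add: replaceable_def)
qed

lemma pure_replaceable:
  fixes S :: "'k::{finite, linorder} bits op set"
  assumes "hormander_system S" "lower_first \<in> S" "cinner u u = 1"
  shows "outer u \<in> replaceable S"
proof -
  obtain z where z: "Abs_endo (replacer (\<chi> x y. if x = z \<and> y = z then 1 else 0)) \<in> channel_endos S"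
    using replacer_basis_channel_endos[OF assms(1,2)] by blast
  define e :: "complex ^ 'k bits" where "e = axis z 1"
  have "outer e = (\<chi> x y. if x = z \<and> y = z then 1 else 0)"
    by (auto simp: outer_def e_def axis_def vec_eq_iff)
  then have e: "outer e \<in> replaceable S"
    using z by (simp add: replaceable_def channel_endos_def Abs_endo_inverse)
  \<comment> \<open>The phase that rotates the \<open>z\<close>-th component of \<open>u\<close>
    onto the nonnegative real axis, as the reflection requires a real inner product; for a zero
    component any phase would do.\<close>
  define c where "c = (if u $ z = 0 then 1 else cnj (u $ z) / cmod (u $ z))"
  have c: "cnj c * c = 1"
    by (auto simp: c_def complex_norm_square[symmetric] power2_eq_square[symmetric] simp flip: of_real_power)
  have "c * u $ z = of_real (cmod (u $ z))"
    by (auto simp: c_def complex_norm_square[symmetric] power2_eq_square mult.commute[of "cnj _"] simp flip: of_real_power)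
  then have "cinner e (c *s u) \<in> \<real>"
    by (simp add: e_def cinner_axis_left)
  moreover have "cinner (c *s u) (c *s u) = 1" "cinner e e = 1"
    using c assms(3) by (simp_all add: cinner_scale_left cinner_scale_right e_def cinner_axis_left) (simp add: mult.commute)
  ultimately obtain V where V: "hermitian V" "V ** V = mat 1" "V *v e = c *s u"
    using reflection_exists by metis
  then have "V ** outer e ** V = outer (c *s u)"
    using mult_outer_adj[of V e] by (simp add: hermitian_def)
  then show ?thesis
    using reflection_replaceable[OF assms(1) V(1,2) e] outer_phase[OF c, of u] by simp
qed

theorem theorem2p8:
  fixes S :: "'k::{finite, linorder} bits op set"
  assumes "hormander_system S"
    and "lower_first \<in> S"
  shows "(\<forall>\<sigma>\<in>states. replacer \<sigma> \<in> channel_closure S) \<and> transitive_ops (channel_closure S)"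
proof -
  have "replacer \<sigma> \<in> channel_closure S" if \<sigma>: "\<sigma> \<in> states" for \<sigma>
  proof -
    have "\<exists>v :: 'k bits \<Rightarrow> _. \<sigma> = (\<Sum>i\<in>UNIV. outer (v i))"
      using \<sigma> by (intro positive_op_sum_outer) (auto simp: states_def)
    then obtain v :: "'k bits \<Rightarrow> _" where v: "\<sigma> = (\<Sum>i\<in>UNIV. outer (v i))" ..
    \<comment> \<open>Zero vectors get an arbitrary unit vector, since their weight is 0. The
      weights \<open>(norm (v i))\<^sup>2\<close> sum to the trace, so they are convex
      coefficients.\<close>
    define u where "u i = (if v i = 0 then axis (\<lambda>_. 0) 1 else inverse (norm (v i)) *\<^sub>R v i)" for i
    have outer: "outer (v i) = (norm (v i))\<^sup>2 *\<^sub>R outer (u i)" for i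
      by (auto simp: u_def outer_scaleR power_inverse) (simp add: outer_def vec_eq_iff)
    have "trace (outer w) = of_real ((norm w)\<^sup>2)" for w :: "complex ^ 'k bits"
      unfolding cinner_self[symmetric] by (simp add: trace_def outer_def cinner_def mult.commute)
    then have "trace \<sigma> = of_real (\<Sum>i\<in>UNIV. (norm (v i))\<^sup>2)"
      unfolding v by (simp add: trace_def sum.swap[of _ UNIV UNIV])
    then have "of_real (\<Sum>i\<in>UNIV. (norm (v i))\<^sup>2) = (1 :: complex)"
      using \<sigma> by (simp add: states_def)
    then have "(\<Sum>i\<in>UNIV. (norm (v i))\<^sup>2) = 1"
      unfolding of_real_eq_1_iff .
    moreover have "outer (u i) \<in> replaceable S" for i
      by (rule pure_replaceable[OF assms]) (simp add: cinner_self u_def)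
    ultimately have "(\<Sum>i\<in>UNIV. (norm (v i))\<^sup>2 *\<^sub>R outer (u i)) \<in> replaceable S"
      by (intro convex_sum convex_replaceable) auto
    then show ?thesis unfolding v outer replaceable_def by simp
  qed
  \<comment> \<open>The discrete alternative holds: on a state, \<open>replacer \<sigma>\<close>
    gives \<sigma> in one step because the trace is 1.\<close>
  moreover from this have "transitive_ops (channel_closure S)"
    unfolding transitive_ops_def
    by (auto simp: states_def replacer.rep_eq intro!: bexI[of _ "replacer _"])
  ultimately show ?thesis by blast
qed

end
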